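(* Let $\alpha=-\frac{1}{2\pi}\theta_2\in\Omega^1(\mathbb{T}^2)$. Then there exists a closed $1$-dimensional (oriented) submanifold $N\subset\mathbb{T}^2$ such that the Lie algebra $2$-cocycles $\omega_\alpha$ and $\omega_N$ on $\mathfrak{g}=\mathfrak{X}_{\mathrm{Ham}}(\mathbb{T}^2)$, given by $$\omega_\alpha(X_f,X_g)=\int_{\mathbb{T}^2} f\,\alpha(X_g)\,d\mathrm{vol},\qquad \omega_N(X_f,X_g)=\int_N f\,dg ,$$ are cohomologous, i.e. $\omega_\alpha-\omega_N\in B^2(\mathfrak{g},\mathbb{R})$.
   Context: $\mathbb{T}^2=\mathbb{S}^1\times\mathbb{S}^1$ is parametrized by $\Phi(t,s)=((\cos t,\sin t),(\cos s,\sin s))$, $(t,s)\in(0,2\pi)^2$, and $\theta_1,\theta_2\in\Omega^1(\mathbb{T}^2)$ are the closed $1$-forms with $\Phi^*\theta_1=dt$, $\Phi^*\theta_2=ds$; the volume (symplectic) form is $\theta_1\wedge\theta_2$. $\mathfrak{g}=\mathfrak{X}_{\mathrm{Ham}}(\mathbb{T}^2)=T_e\mathcal{D}_{\mathrm{Ham}}(\mathbb{T}^2)$ is the Lie algebra of (smooth) Hamiltonian vector fields; the Hamiltonian vector field of $f$ is $X_f=\nabla^\perp f=(-\partial_2 f,\partial_1 f)$. Lie algebra cohomology: for $n\ge 0$, $C^n(\mathfrak{g},\mathbb{R})$ is the space of $n$-linear alternating continuous maps $\mathfrak{g}^n\to\mathbb{R}$, with differential $d\mu(x_0,\dots,x_n)=\sum_{0\le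 i<j\le n}(-1)^{i+j}\mu([x_i,x_j],x_0,\dots,\widehat{x}_i,\dots,\widehat{x}_j,\dots,x_n)$ (and $d=0$ on $C^0$). $Z^n=\ker d$ is the space of $n$-cocycles, and $B^n(\mathfrak{g},\mathbb{R})=d\,C^{n-1}(\mathfrak{g},\mathbb{R})$ the space of $n$-coboundaries. *)

theory Defs
  imports "HOL-Analysis.Analysis"
begin

section \<open>Smooth maps between Euclidean spaces\<close>

primrec Ck_on :: "nat \<Rightarrow> 'a::euclidean_space set \<Rightarrow> ('a \<Rightarrow> 'b::real_normed_vector) \<Rightarrow> bool" where
  "Ck_on 0 S f \<longleftrightarrow> continuous_on S f"
| "Ck_on (Suc k) S f \<longleftrightarrow>
     (\<forall>x\<in>S. f differentiable (at x)) \<and> (\<forall>v. Ck_on k S (\<lambda>x. frechet_derivative f (at x) v))"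

text \<open>Only meaningful for open \<open>S\<close>.\<close>

definition smooth_on :: "'a::euclidean_space set \<Rightarrow> ('a \<Rightarrow> 'b::real_normed_vector) \<Rightarrow> bool" where
  "smooth_on S f \<longleftrightarrow> (\<forall>k. Ck_on k S f)"


section \<open>The torus\<close>

typedef circle = "{z::complex. norm z = 1}"
  by (rule exI[of _ 1]) simp

instantiation circle :: metric_space
begin

definition dist_circle :: "circle \<Rightarrow> circle \<Rightarrow> real" where
  "dist_circle z w = dist (Rep_circle z) (Rep_circle w)"

definition uniformity_circle :: "(circle \<times> circle) filter" where
  "uniformity_circle = (INF e\<in>{0<..}. principal {(x, y). dist x y < e})"

definition open_circle :: "circle set \<Rightarrow> bool" where
  "open_circle U \<longleftrightarrow> (\<forall>x\<in>U. \<forall>\<^sub>F (x', y) in uniformity. x' = x \<longrightarrow> y \<in> U)"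

instance
proof
  show "uniformity = (INF e\<in>{0<..}. principal {(x::circle, y). dist x y < e})"
    by (rule uniformity_circle_def)
  show "open U = (\<forall>x\<in>U. \<forall>\<^sub>F (x', y) in uniformity. x' = x \<longrightarrow> y \<in> U)" for U :: "circle set"
    by (rule open_circle_def)
  show "(dist x y = 0) = (x = y)" for x y :: circle
    by (simp add: dist_circle_def Rep_circle_inject)
  show "dist x y \<le> dist x z + dist y z" for x y z :: circle
    by (simp add: dist_circle_def dist_triangle2)
qed

end

type_synonym torus = "circle \<times> circle"

text \<open>The parametrization \<open>(t, s) \<mapsto> ((cos t, sin t), (cos s, sin s))\<close>, considered on the whole
  plane: it is the universal covering.\<close>

definition Phi :: "real \<times> real \<Rightarrow> torus" where
  "Phi x = (Abs_circle (cis (fst x)), Abs_circle (cis (snd x)))"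

definition smooth_torus :: "(torus \<Rightarrow> 'b::real_normed_vector) \<Rightarrow> bool" where
  "smooth_torus F \<longleftrightarrow> smooth_on UNIV (F \<circ> Phi)"

text \<open>Tangent vectors of the torus are written in the global frame \<open>\<partial>\<^sub>1, \<partial>\<^sub>2\<close> dual to
  \<open>\<theta>\<^sub>1, \<theta>\<^sub>2\<close>, that is, \<open>v :: real \<times> real\<close> at \<open>Phi x\<close> stands for the image of \<open>v\<close> under the
  differential of \<open>Phi\<close> at \<open>x\<close>; this image depends on \<open>Phi x\<close> and \<open>v\<close> only. A vector field
  is then a map into the plane, and a 1-form is a map \<open>torus \<Rightarrow> real \<times> real \<Rightarrow> real\<close>.\<close>

type_synonym vfield = "torus \<Rightarrow> real \<times> real"
type_synonym oneform = "torus \<Rightarrow> real \<times> real \<Rightarrow> real"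

definition theta1 :: oneform where "theta1 p v = fst v"
definition theta2 :: oneform where "theta2 p v = snd v"

text \<open>Derivative of \<open>F\<close> at \<open>p\<close> in direction \<open>v\<close>. By periodicity of \<open>F \<circ> Phi\<close> the choice of the
  preimage of \<open>p\<close> is immaterial. For real-valued \<open>F\<close> this is the 1-form \<open>dF\<close>.\<close>

definition tderiv :: "(torus \<Rightarrow> 'b::real_normed_vector) \<Rightarrow> torus \<Rightarrow> real \<times> real \<Rightarrow> 'b" where
  "tderiv F p v = frechet_derivative (F \<circ> Phi) (at (inv Phi p)) v"

definition pd1 :: "(torus \<Rightarrow> 'b::real_normed_vector) \<Rightarrow> torus \<Rightarrow> 'b" where
  "pd1 F p = tderiv F p (1, 0)"

definition pd2 :: "(torus \<Rightarrow> 'b::real_normed_vector) \<Rightarrow> torus \<Rightarrow> 'b" where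
  "pd2 F p = tderiv F p (0, 1)"

text \<open>Integration against \<open>\<theta>\<^sub>1 \<and> \<theta>\<^sub>2\<close>, whose pullback under \<open>Phi\<close> is \<open>dt \<and> ds\<close>.\<close>

definition torus_integral :: "(torus \<Rightarrow> real) \<Rightarrow> real" where
  "torus_integral h = (LINT x:({0<..<2*pi} \<times> {0<..<2*pi})|lborel. h (Phi x))"


section \<open>The Lie algebra of Hamiltonian vector fields\<close>

definition ham_vf :: "(torus \<Rightarrow> real) \<Rightarrow> vfield" where
  "ham_vf f p = (- pd2 f p, pd1 f p)"

definition ham_alg :: "vfield set" where
  "ham_alg = {ham_vf f | f. smooth_torus f}"

text \<open>The frame fields commute, so the bracket of vector fields has no further terms.\<close>

definition lie_bracket :: "vfield \<Rightarrow> vfield \<Rightarrow> vfield" where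
  "lie_bracket X Y p = tderiv Y p (X p) - tderiv X p (Y p)"

definition vf_seminorm :: "nat \<Rightarrow> nat \<Rightarrow> vfield \<Rightarrow> real" where
  "vf_seminorm i j X = (SUP p. norm ((pd1 ^^ i) ((pd2 ^^ j) X) p))"

text \<open>The (Frechet) topology of uniform convergence of all derivatives.\<close>

definition ham_topology :: "vfield topology" where
  "ham_topology = topology_generated_by
     {{Y \<in> ham_alg. vf_seminorm i j (\<lambda>p. Y p - X p) < e} | X i j e. X \<in> ham_alg \<and> e > 0}"


section \<open>Continuous Lie algebra cohomology\<close>

text \<open>An \<open>n\<close>-tuple \<open>(x\<^sub>0, \<dots>, x\<^sub>n\<^sub>-\<^sub>1)\<close> is a list of length \<open>n\<close>. A cochain of degree \<open>n\<close> is
  a function on lists of vector fields of which only the values on \<open>tuples n\<close> matter; all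
  identities between cochains are required on these tuples only.\<close>

definition tuples :: "nat \<Rightarrow> vfield list set" where
  "tuples n = {xs. length xs = n \<and> set xs \<subseteq> ham_alg}"

definition multilinear :: "nat \<Rightarrow> (vfield list \<Rightarrow> real) \<Rightarrow> bool" where
  "multilinear n \<mu> \<longleftrightarrow>
     (\<forall>xs\<in>tuples n. \<forall>i<n. \<forall>X\<in>ham_alg. \<forall>Y\<in>ham_alg. \<forall>a b.
        \<mu> (xs[i := (\<lambda>p. a *\<^sub>R X p + b *\<^sub>R Y p)]) = a * \<mu> (xs[i := X]) + b * \<mu> (xs[i := Y]))"

definition alternating :: "nat \<Rightarrow> (vfield list \<Rightarrow> real) \<Rightarrow> bool" where
  "alternating n \<mu> \<longleftrightarrow> (\<forall>xs\<in>tuples n. \<forall>i j. i < j \<and> j < n \<and> xs ! i = xs ! j \<longrightarrow> \<mu> xs = 0)"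

definition continuous_cochain :: "nat \<Rightarrow> (vfield list \<Rightarrow> real) \<Rightarrow> bool" where
  "continuous_cochain n \<mu> \<longleftrightarrow>
     continuous_map (product_topology (\<lambda>_. ham_topology) {..<n}) euclideanreal
       (\<lambda>x. \<mu> (map x [0..<n]))"

definition cochains :: "nat \<Rightarrow> (vfield list \<Rightarrow> real) set" where
  "cochains n = {\<mu>. multilinear n \<mu> \<and> alternating n \<mu> \<and> continuous_cochain n \<mu>}"

text \<open>\<open>nths xs (- {i, j})\<close> omits the entries \<open>i\<close> and \<open>j\<close>. On 1-tuples the sum is empty, so the
  differential of a 0-cochain vanishes.\<close>

definition ce_diff :: "(vfield list \<Rightarrow> real) \<Rightarrow> vfield list \<Rightarrow> real" where
  "ce_diff \<mu> xs =
     (\<Sum>(i, j) \<in> {(i, j). i < j \<and> j < length xs}.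
        (-1) ^ (i + j) * \<mu> (lie_bracket (xs ! i) (xs ! j) # nths xs (- {i, j})))"

definition cocycles :: "nat \<Rightarrow> (vfield list \<Rightarrow> real) set" where
  "cocycles n = {\<mu> \<in> cochains n. \<forall>xs\<in>tuples (Suc n). ce_diff \<mu> xs = 0}"

text \<open>For \<open>n \<ge> 1\<close>.\<close>

definition coboundaries :: "nat \<Rightarrow> (vfield list \<Rightarrow> real) set" where
  "coboundaries n = {\<omega>. \<exists>\<mu>\<in>cochains (n - 1). \<forall>xs\<in>tuples n. \<omega> xs = ce_diff \<mu> xs}"


section \<open>Closed oriented 1-dimensional submanifolds\<close>

text \<open>A local parametrization of \<open>N\<close> is an immersion of an open interval which is a homeomorphism
  onto an open subset of \<open>N\<close>. It is given through a lift \<open>u\<close> to the plane (every curve in the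
  torus has one), so that its velocity in the frame \<open>\<partial>\<^sub>1, \<partial>\<^sub>2\<close> is the derivative of \<open>u\<close>.\<close>

definition local_param :: "torus set \<Rightarrow> real \<Rightarrow> real \<Rightarrow> (real \<Rightarrow> real \<times> real) \<Rightarrow> bool" where
  "local_param N a b u \<longleftrightarrow>
     a < b \<and> smooth_on {a<..<b} u \<and>
     (\<forall>t\<in>{a<..<b}. vector_derivative u (at t) \<noteq> 0) \<and>
     openin (top_of_set N) ((Phi \<circ> u) ` {a<..<b}) \<and>
     (\<exists>v. homeomorphism {a<..<b} ((Phi \<circ> u) ` {a<..<b}) (Phi \<circ> u) v)"

definition closed_submanifold1 :: "torus set \<Rightarrow> bool" where
  "closed_submanifold1 N \<longleftrightarrow>
     compact N \<and> N \<noteq> {} \<and>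
     (\<forall>p\<in>N. \<exists>a b u. local_param N a b u \<and> p \<in> (Phi \<circ> u) ` {a<..<b})"

text \<open>An orientation is recorded by the tangent field \<open>\<tau>\<close> of unit length (in the flat metric)
  pointing in positive direction.\<close>

definition pos_param ::
    "torus set \<Rightarrow> vfield \<Rightarrow> real \<Rightarrow> real \<Rightarrow> (real \<Rightarrow> real \<times> real) \<Rightarrow> bool" where
  "pos_param N \<tau> a b u \<longleftrightarrow>
     local_param N a b u \<and>
     (\<forall>t\<in>{a<..<b}. vector_derivative u (at t)
                     = norm (vector_derivative u (at t)) *\<^sub>R \<tau> (Phi (u t)))"

definition orientation1 :: "torus set \<Rightarrow> vfield \<Rightarrow> bool" where
  "orientation1 N \<tau> \<longleftrightarrow> (\<forall>p\<in>N. \<exists>a b u. pos_param N \<tau> a b u \<and> p \<in> (Phi \<circ> u) ` {a<..<b})"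

text \<open>Integration of a 1-form over \<open>N\<close> by means of positively oriented local parametrizations
  \<open>u i\<close> and a subordinate partition of unity \<open>\<rho> i\<close>; as no derivative of \<open>\<rho> i\<close> is ever taken,
  continuity of \<open>\<rho> i\<close> suffices.\<close>

definition has_form_integral :: "oneform \<Rightarrow> torus set \<Rightarrow> vfield \<Rightarrow> real \<Rightarrow> bool" where
  "has_form_integral \<beta> N \<tau> I \<longleftrightarrow>
     (\<exists>(n::nat) a b u \<rho>.
        (\<forall>i<n. pos_param N \<tau> (a i) (b i) (u i) \<and>
               continuous_on N (\<rho> i) \<and> (\<forall>p\<in>N. 0 \<le> \<rho> i p) \<and>
               closure {p \<in> N. \<rho> i p \<noteq> 0} \<subseteq> (Phi \<circ> u i) ` {a i<..<b i}) \<and>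
        (\<forall>p\<in>N. (\<Sum>i<n. \<rho> i p) = 1) \<and>
        I = (\<Sum>i<n. LINT t:{a i<..<b i}|lborel.
               \<rho> i (Phi (u i t)) * \<beta> (Phi (u i t)) (vector_derivative (u i) (at t))))"

definition form_integral :: "oneform \<Rightarrow> torus set \<Rightarrow> vfield \<Rightarrow> real" where
  "form_integral \<beta> N \<tau> = (THE I. has_form_integral \<beta> N \<tau> I)"

end

theory Submission
  imports Defs
begin

text \<open>Take for \<open>N\<close> the circle \<open>s = 0\<close> with the orientation \<open>-\<partial>\<^sub>1\<close>. Both cocycles then have the form
  \<open>\<omega>(X\<^sub>f, X\<^sub>g) = L(f \<partial>\<^sub>1 g)\<close> with a continuous functional \<open>L\<close> that vanishes on first partial derivatives:
  \<open>L h = -1/(2\<pi>) \<integral>\<integral> h(t, s) dt ds\<close> for \<open>\<omega>\<^sub>\<alpha>\<close> and \<open>L h = -\<integral> h(t, 0) dt\<close> for \<open>\<omega>\<^sub>N\<close>. The first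
  component of \<open>[X\<^sub>f, X\<^sub>g]\<close> equals \<open>\<partial>\<^sub>2\<partial>\<^sub>2(f \<partial>\<^sub>1 g)\<close> up to a derivative in direction \<open>t\<close>, so integrating it
  against the weight \<open>(s\<^sup>2/2 - \<pi>s)/(2\<pi>)\<close> and integrating by parts twice in \<open>s\<close> yields the difference of the
  two functionals: \<open>\<omega>\<^sub>\<alpha> - \<omega>\<^sub>N\<close> is the differential of this continuous linear functional of the vector field.\<close>

section \<open>Smooth functions on the plane\<close>

text \<open>The weight is a Green function: as a periodic distribution in s it solves w'' = 1/(2 pi)
  - delta_0, so pairing it with a second s-derivative compares a mean over the torus with the values
  on s = 0. Such a w exists only because both functionals take the same value, -2 pi, on the
  constant 1; this is what the factor 1/(2 pi) in \<alpha> achieves, and the sign of \<alpha>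
  dictates the orientation of N. Behind this is Poincare duality: for closed 1-forms \<beta>, the
  integral of \<beta> over N is that of \<beta> wedge \<alpha> over the torus. Two obstacles shape
  the rest. Cochains are functions of vector fields, whereas the formulas use Hamiltonians, which a
  field determines only up to a constant; hence the normalised potentials and their sup-norm
  estimate. And the integral over N is a definite description ranging over all positive charts and
  all partitions of unity, so it has to be evaluated for arbitrary admissible data; this is the
  purpose of the last section.\<close>

lemma Ck_on_Suc_imp: "Ck_on (Suc k) S f \<Longrightarrow> Ck_on k S f"
proof (induction k arbitrary: f)
  case 0
  then show ?case
    by (auto intro!: differentiable_imp_continuous_on simp: differentiable_on_def differentiable_at_withinI)
next
  case (Suc k)
  then show ?case by (metis Ck_on.simps(2))
qed

lemma Ck_on_const: "Ck_on k S (\<lambda>_. c)"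
  by (induction k arbitrary: c) auto

lemma Ck_on_add:
  "Ck_on k UNIV f \<Longrightarrow> Ck_on k UNIV g \<Longrightarrow> Ck_on k UNIV (\<lambda>x. f x + g x)"
proof (induction k arbitrary: f g)
  case 0
  then show ?case by (auto intro: continuous_on_add)
next
  case (Suc k)
  have d: "((\<lambda>x. f x + g x) has_derivative
      (\<lambda>v. frechet_derivative f (at x) v + frechet_derivative g (at x) v)) (at x)" for x
    using Suc.prems by (intro has_derivative_add) (auto intro: frechet_derivative_works[THEN iffD1])
  have "frechet_derivative (\<lambda>x. f x + g x) (at x) =
      (\<lambda>v. frechet_derivative f (at x) v + frechet_derivative g (at x) v)" for x
    by (rule frechet_derivative_at[OF d, symmetric])
  then show ?case
    using Suc.prems differentiableI[OF d] by (simp add: Suc.IH)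
qed

lemma Ck_on_mult:
  fixes f g :: "'a::euclidean_space \<Rightarrow> real"
  shows "Ck_on k UNIV f \<Longrightarrow> Ck_on k UNIV g \<Longrightarrow> Ck_on k UNIV (\<lambda>x. f x * g x)"
proof (induction k arbitrary: f g)
  case 0
  then show ?case by (auto intro: continuous_on_mult)
next
  case (Suc k)
  have d: "((\<lambda>x. f x * g x) has_derivative
      (\<lambda>v. f x * frechet_derivative g (at x) v + frechet_derivative f (at x) v * g x)) (at x)" for x
    using Suc.prems by (intro has_derivative_mult) (auto intro: frechet_derivative_works[THEN iffD1])
  have "frechet_derivative (\<lambda>x. f x * g x) (at x) =
      (\<lambda>v. f x * frechet_derivative g (at x) v + frechet_derivative f (at x) v * g x)" for x
    by (rule frechet_derivative_at[OF d, symmetric])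
  \<comment> \<open>The product rule leaves one factor undifferentiated, so the induction hypothesis
    also needs the factors themselves in class k.\<close>
  moreover have "Ck_on k UNIV f" "Ck_on k UNIV g"
    using Suc.prems Ck_on_Suc_imp by blast+
  ultimately show ?case
    using Suc.prems differentiableI[OF d] by (simp add: Ck_on_add Suc.IH)
qed

lemma smooth_on_frechet_derivative:
  "smooth_on S f \<Longrightarrow> smooth_on S (\<lambda>x. frechet_derivative f (at x) v)"
  unfolding smooth_on_def using Ck_on.simps(2) by blast

lemma smooth_on_imp_differentiable: "smooth_on S f \<Longrightarrow> x \<in> S \<Longrightarrow> f differentiable (at x)"
  unfolding smooth_on_def using Ck_on.simps(2) by blast

lemma smooth_on_imp_continuous_on: "smooth_on S f \<Longrightarrow> continuous_on S f"
  unfolding smooth_on_def using Ck_on.simps(1) by blast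

lemma DERIV_fst:
  fixes f :: "real \<times> real \<Rightarrow> real"
  assumes "f differentiable (at (t, s))"
  shows "((\<lambda>t. f (t, s)) has_real_derivative frechet_derivative f (at (t, s)) (1, 0)) (at t within S)"
proof -
  have "(f has_derivative frechet_derivative f (at (t, s))) (at (t, s))"
    using assms by (simp add: frechet_derivative_works)
  then have "((f \<circ> (\<lambda>t. (t, s))) has_derivative
      frechet_derivative f (at (t, s)) \<circ> (\<lambda>h. (h, 0))) (at t)"
    by (intro diff_chain_at) (auto intro!: derivative_eq_intros)
  moreover have "frechet_derivative f (at (t, s)) \<circ> (\<lambda>h. (h, 0))
      = (*) (frechet_derivative f (at (t, s)) (1, 0))"
  proof
    show "(frechet_derivative f (at (t, s)) \<circ> (\<lambda>h. (h, 0))) h = frechet_derivative f (at (t, s)) (1, 0) * h" for h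
      using linear_scale[OF linear_frechet_derivative[OF assms], of h "(1, 0)"] by (simp add: mult.commute)
  qed
  ultimately show ?thesis
    unfolding has_field_derivative_def o_def by (metis has_derivative_at_withinI)
qed

lemma DERIV_snd:
  fixes f :: "real \<times> real \<Rightarrow> real"
  assumes "f differentiable (at (t, s))"
  shows "((\<lambda>s. f (t, s)) has_real_derivative frechet_derivative f (at (t, s)) (0, 1)) (at s within S)"
proof -
  have "(f has_derivative frechet_derivative f (at (t, s))) (at (t, s))"
    using assms by (simp add: frechet_derivative_works)
  then have "((f \<circ> (\<lambda>s. (t, s))) has_derivative
      frechet_derivative f (at (t, s)) \<circ> (\<lambda>h. (0, h))) (at s)"
    by (intro diff_chain_at) (auto intro!: derivative_eq_intros)
  moreover have "frechet_derivative f (at (t, s)) \<circ> (\<lambda>h. (0, h))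
      = (*) (frechet_derivative f (at (t, s)) (0, 1))"
  proof
    show "(frechet_derivative f (at (t, s)) \<circ> (\<lambda>h. (0, h))) h = frechet_derivative f (at (t, s)) (0, 1) * h" for h
      using linear_scale[OF linear_frechet_derivative[OF assms], of h "(0, 1)"] by (simp add: mult.commute)
  qed
  ultimately show ?thesis
    unfolding has_field_derivative_def o_def by (metis has_derivative_at_withinI)
qed

text \<open>Schwarz's theorem: write \<open>f(t, s) - f(a, s)\<close> as the integral of its first partial derivative,
  differentiate in \<open>s\<close> under the integral sign, and then in \<open>t\<close>.\<close>

lemma frechet_derivative_commute:
  fixes f :: "real \<times> real \<Rightarrow> real"
  assumes f: "smooth_on UNIV f"
  defines "f1 \<equiv> \<lambda>x. frechet_derivative f (at x) (1, 0)"
    and "f2 \<equiv> \<lambda>x. frechet_derivative f (at x) (0, 1)"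
  shows "frechet_derivative f1 (at x) (0, 1) = frechet_derivative f2 (at x) (1, 0)"
proof -
  obtain t0 s0 where x: "x = (t0, s0)" by fastforce
  define f12 where "f12 = (\<lambda>x. frechet_derivative f1 (at x) (0, 1))"
  have s1: "smooth_on UNIV f1" and s2: "smooth_on UNIV f2"
    unfolding f1_def f2_def using f by (auto intro: smooth_on_frechet_derivative)
  then have s12: "smooth_on UNIV f12"
    unfolding f12_def by (auto intro: smooth_on_frechet_derivative)
  note c1 = smooth_on_imp_continuous_on[OF s1] and c12 = smooth_on_imp_continuous_on[OF s12]
  have D1: "((\<lambda>t. f (t, s)) has_real_derivative f1 (t, s)) (at t within S)"
    and D2: "((\<lambda>s. f (t, s)) has_real_derivative f2 (t, s)) (at s within S)"
    and D12: "((\<lambda>s. f1 (t, s)) has_real_derivative f12 (t, s)) (at s within S)"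
    and D21: "((\<lambda>t. f2 (t, s)) has_real_derivative frechet_derivative f2 (at (t, s)) (1, 0))
      (at t within S)" for t s S
    using f s1 s2 by (auto simp: f1_def f2_def f12_def
        intro!: DERIV_fst DERIV_snd smooth_on_imp_differentiable[of UNIV])
  \<comment> \<open>The base point lies strictly to the left of \<open>t0\<close>, so that
    \<open>t0\<close> is interior to \<open>{a..t0+1}\<close> and the one-interval derivative below
    becomes a full one.\<close>
  define a where "a = t0 - 1"
  have f2_eq: "f2 (t, s0) = integral {a..t} (\<lambda>\<tau>. f12 (\<tau>, s0)) + f2 (a, s0)" if "a \<le> t" for t
  proof -
    have f_eq: "integral {a..t} (\<lambda>\<tau>. f1 (\<tau>, s)) = f (t, s) - f (a, s)" for s
      using that by (intro integral_unique fundamental_theorem_of_calculus)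
        (auto intro: D1 simp flip: has_real_derivative_iff_has_vector_derivative)
    have "((\<lambda>s. integral (cbox a t) (\<lambda>\<tau>. f1 (\<tau>, s))) has_real_derivative
        integral (cbox a t) (\<lambda>\<tau>. f12 (\<tau>, s0))) (at s0 within UNIV)"
    proof (rule leibniz_rule_field_derivative)
      show "continuous_on (UNIV \<times> cbox a t) (\<lambda>(s, \<tau>). f12 (\<tau>, s))"
        unfolding split_beta by (intro continuous_on_compose2[OF c12] continuous_intros) auto
      show "(\<lambda>\<tau>. f1 (\<tau>, s)) integrable_on cbox a t" for s
        by (intro integrable_continuous continuous_on_compose2[OF c1] continuous_intros) auto
    qed (auto intro: D12)
    then have "((\<lambda>s. f (t, s) - f (a, s)) has_real_derivative
        integral {a..t} (\<lambda>\<tau>. f12 (\<tau>, s0))) (at s0)"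
      by (simp add: f_eq)
    moreover have "((\<lambda>s. f (t, s) - f (a, s)) has_real_derivative f2 (t, s0) - f2 (a, s0)) (at s0)"
      by (intro DERIV_diff D2)
    ultimately show ?thesis
      using DERIV_unique by force
  qed
  have "continuous_on {a..t0+1} (\<lambda>\<tau>. f12 (\<tau>, s0))"
    by (intro continuous_on_compose2[OF c12] continuous_intros) auto
  then have "((\<lambda>t. integral {a..t} (\<lambda>\<tau>. f12 (\<tau>, s0))) has_real_derivative f12 (t0, s0))
      (at t0 within {a..t0+1})"
    by (rule integral_has_real_derivative) (simp add: a_def)
  from DERIV_add[OF this DERIV_const[of "f2 (a, s0)"]]
  have "((\<lambda>t. integral {a..t} (\<lambda>\<tau>. f12 (\<tau>, s0)) + f2 (a, s0)) has_real_derivative f12 (t0, s0))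
      (at t0 within {a..t0+1})"
    by simp
  then have "((\<lambda>t. f2 (t, s0)) has_real_derivative f12 (t0, s0)) (at t0 within {a..t0+1})"
    by (rule has_field_derivative_transform_within[where d=1])
      (auto simp: a_def intro!: f2_eq[symmetric, unfolded a_def])
  moreover have "at t0 within {a..t0+1} = at t0"
    by (rule at_within_interior) (auto simp: a_def)
  ultimately have "((\<lambda>t. f2 (t, s0)) has_real_derivative f12 (t0, s0)) (at t0)"
    by simp
  then show ?thesis
    using DERIV_unique[OF _ D21[of _ _ UNIV]] unfolding x f12_def by blast
qed

section \<open>Calculus on the torus\<close>

lemma Rep_circle_Abs_cis [simp]: "Rep_circle (Abs_circle (cis t)) = cis t"
  by (simp add: Abs_circle_inverse)

lemma Abs_circle_cis_eq_iff: "Abs_circle (cis s) = Abs_circle (cis t) \<longleftrightarrow> (\<exists>n::int. s = t + 2 * pi * n)"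
proof -
  have "Abs_circle (cis s) = Abs_circle (cis t) \<longleftrightarrow> cis s = cis t"
    by (simp add: Abs_circle_inject)
  also have "\<dots> \<longleftrightarrow> sin s = sin t \<and> cos s = cos t"
    by (auto simp: complex_eq_iff)
  finally show ?thesis by (simp add: sin_cos_eq_iff)
qed

lemma Phi_eq_iff:
  "Phi x = Phi y \<longleftrightarrow> (\<exists>(m::int) (n::int). fst x = fst y + 2 * pi * m \<and> snd x = snd y + 2 * pi * n)"
  by (simp add: Phi_def Abs_circle_cis_eq_iff)

lemma Abs_circle_cis_surj: "\<exists>t\<in>{0..2*pi}. z = Abs_circle (cis t)"
proof -
  have "norm (Rep_circle z) = 1"
    using Rep_circle by auto
  then have "(Re (Rep_circle z))\<^sup>2 + (Im (Rep_circle z))\<^sup>2 = 1"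
    by (simp add: cmod_def)
  then obtain t where "0 \<le> t" "t < 2*pi" "Re (Rep_circle z) = cos t" "Im (Rep_circle z) = sin t"
    using sincos_total_2pi by metis
  then have "z = Abs_circle (cis t)"
    by (metis Rep_circle_inverse cis.code complex.collapse)
  then show ?thesis using \<open>0 \<le> t\<close> \<open>t < 2*pi\<close> by auto
qed

lemma Phi_surj_square: "\<exists>x\<in>cbox (0, 0) (2*pi, 2*pi). p = Phi x"
proof -
  obtain t s where "t \<in> {0..2*pi}" "s \<in> {0..2*pi}"
    "fst p = Abs_circle (cis t)" "snd p = Abs_circle (cis s)"
    using Abs_circle_cis_surj by metis
  then show ?thesis
    by (intro bexI[of _ "(t, s)"]) (auto simp: Phi_def prod_eq_iff cbox_Pair_eq)
qed

lemma Phi_cases: obtains t s where "p = Phi (t, s)"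
  using Phi_surj_square[of p] by auto

lemma continuous_on_Abs_circle_cis: "continuous_on S (\<lambda>t. Abs_circle (cis t))"
proof -
  have "continuous_on S cis" by (intro continuous_intros)
  then show ?thesis
    by (simp add: continuous_on_iff dist_circle_def)
qed

lemma continuous_on_Rep_circle: "continuous_on S Rep_circle"
  by (auto simp: continuous_on_iff dist_circle_def)

lemma continuous_on_Phi: "continuous_on S Phi"
  unfolding Phi_def
  by (intro continuous_on_Pair continuous_on_compose2[OF continuous_on_Abs_circle_cis] continuous_intros) auto

text \<open>\<open>frechet_derivative\<close> is a choice among all derivatives, so it suffices that
  the same linear maps are derivatives at both points. This covers points where \<open>f\<close> is
  not differentiable as well.\<close>

lemma frechet_derivative_periodic:
  assumes "\<And>y. f (y + c) = f y"
  shows "frechet_derivative f (at (x + c)) = frechet_derivative f (at x)"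
proof -
  have *: "(f has_derivative D) (at (x + c))" if "(f has_derivative D) (at x)"
    "\<And>y. f (y + c) = f y" for f :: "'a::real_normed_vector \<Rightarrow> 'b::real_normed_vector" and D x c
  proof -
    have "((f \<circ> (\<lambda>y. y - c)) has_derivative D \<circ> (\<lambda>v. v)) (at (x + c))"
      by (rule diff_chain_at) (use that in \<open>auto intro!: derivative_eq_intros\<close>)
    moreover have "f \<circ> (\<lambda>y. y - c) = f"
      using that(2)[of "y - c" for y] by (auto simp: fun_eq_iff)
    ultimately show ?thesis by (simp add: o_def)
  qed
  have "f (y - c) = f y" for y
    using assms[of "y - c"] by simp
  then have "(f has_derivative D) (at (x + c)) \<longleftrightarrow> (f has_derivative D) (at x)" for D
    using *[of f D x c] *[of f D "x + c" "- c"] assms by auto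
  then show ?thesis
    by (simp add: frechet_derivative_def)
qed

text \<open>The preimage chosen by \<open>inv Phi\<close> differs from \<open>x\<close> by a vector
  of the period lattice. From here on calculus on the torus is calculus on the plane, at whichever
  preimage is convenient.\<close>

lemma tderiv_Phi: "tderiv F (Phi x) v = frechet_derivative (F \<circ> Phi) (at x) v"
proof -
  have "Phi (inv Phi (Phi x)) = Phi x"
    by (metis f_inv_into_f rangeI)
  then obtain m n :: int where "inv Phi (Phi x) = x + (2 * pi * m, 2 * pi * n)"
    unfolding Phi_eq_iff by (auto simp: prod_eq_iff)
  moreover have "Phi (y + (2 * pi * m, 2 * pi * n)) = Phi y" for y
    unfolding Phi_eq_iff by auto
  ultimately show ?thesis
    unfolding tderiv_def by (simp add: frechet_derivative_periodic)
qed

lemma smooth_torus_differentiable: "smooth_torus F \<Longrightarrow> (F \<circ> Phi) differentiable (at x)"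
  by (simp add: smooth_torus_def smooth_on_imp_differentiable)

lemma smooth_torus_continuous: "smooth_torus F \<Longrightarrow> continuous_on S (F \<circ> Phi)"
  unfolding smooth_torus_def using smooth_on_imp_continuous_on continuous_on_subset by blast

lemma smooth_torus_pd1: "smooth_torus F \<Longrightarrow> smooth_torus (pd1 F)"
  and smooth_torus_pd2: "smooth_torus F \<Longrightarrow> smooth_torus (pd2 F)"
  unfolding smooth_torus_def o_def pd1_def pd2_def tderiv_Phi
  by (auto intro: smooth_on_frechet_derivative)

lemma smooth_torus_const: "smooth_torus (\<lambda>_. c)"
  unfolding smooth_torus_def smooth_on_def o_def by (simp add: Ck_on_const)

lemma smooth_torus_add:
  "smooth_torus F \<Longrightarrow> smooth_torus G \<Longrightarrow> smooth_torus (\<lambda>p. F p + G p)"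
  unfolding smooth_torus_def smooth_on_def o_def by (simp add: Ck_on_add)

lemma smooth_torus_mult:
  fixes F G :: "torus \<Rightarrow> real"
  shows "smooth_torus F \<Longrightarrow> smooth_torus G \<Longrightarrow> smooth_torus (\<lambda>p. F p * G p)"
  unfolding smooth_torus_def smooth_on_def o_def by (simp add: Ck_on_mult)

lemma smooth_torus_scale:
  fixes F :: "torus \<Rightarrow> real"
  shows "smooth_torus F \<Longrightarrow> smooth_torus (\<lambda>p. c * F p)"
  by (simp add: smooth_torus_mult smooth_torus_const)

lemma smooth_torus_minus:
  fixes F :: "torus \<Rightarrow> real"
  shows "smooth_torus F \<Longrightarrow> smooth_torus (\<lambda>p. - F p)"
  using smooth_torus_scale[of F "-1"] by simp

lemma smooth_torus_diff:
  fixes F G :: "torus \<Rightarrow> real"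
  shows "smooth_torus F \<Longrightarrow> smooth_torus G \<Longrightarrow> smooth_torus (\<lambda>p. F p - G p)"
  using smooth_torus_add[OF _ smooth_torus_minus, of F G] by simp

lemmas smooth_torus_intros = smooth_torus_const smooth_torus_add smooth_torus_mult
  smooth_torus_minus smooth_torus_diff smooth_torus_pd1 smooth_torus_pd2

lemma has_derivative_tderiv:
  "smooth_torus F \<Longrightarrow> ((\<lambda>x. F (Phi x)) has_derivative tderiv F (Phi x)) (at x)"
  using smooth_torus_differentiable[of F x]
  by (simp add: frechet_derivative_works o_def tderiv_Phi[abs_def])

lemma tderiv_eqI:
  assumes "((\<lambda>x. F (Phi x)) has_derivative D) (at x)"
  shows "tderiv F (Phi x) = D"
  using frechet_derivative_at[OF assms] by (simp add: tderiv_Phi[abs_def] o_def)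

lemma tderiv_const: "tderiv (\<lambda>_. c) p = (\<lambda>_. 0)"
  by (cases p rule: Phi_cases) (auto intro: tderiv_eqI)

lemma tderiv_add:
  assumes "smooth_torus F" "smooth_torus G"
  shows "tderiv (\<lambda>p. F p + G p) p = (\<lambda>v. tderiv F p v + tderiv G p v)"
  by (cases p rule: Phi_cases)
    (auto intro!: tderiv_eqI has_derivative_add has_derivative_tderiv assms)

lemma tderiv_mult:
  fixes F G :: "torus \<Rightarrow> real"
  assumes "smooth_torus F" "smooth_torus G"
  shows "tderiv (\<lambda>p. F p * G p) p = (\<lambda>v. F p * tderiv G p v + tderiv F p v * G p)"
  by (cases p rule: Phi_cases)
    (auto intro!: tderiv_eqI has_derivative_mult has_derivative_tderiv assms)

lemma tderiv_scale:
  fixes F :: "torus \<Rightarrow> real"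
  assumes "smooth_torus F"
  shows "tderiv (\<lambda>p. c * F p) p = (\<lambda>v. c * tderiv F p v)"
  by (simp add: tderiv_mult assms smooth_torus_const tderiv_const)

lemma tderiv_minus:
  fixes F :: "torus \<Rightarrow> real"
  assumes "smooth_torus F"
  shows "tderiv (\<lambda>p. - F p) p = (\<lambda>v. - tderiv F p v)"
  using tderiv_scale[OF assms, of "-1"] by simp

lemma tderiv_diff:
  fixes F G :: "torus \<Rightarrow> real"
  assumes "smooth_torus F" "smooth_torus G"
  shows "tderiv (\<lambda>p. F p - G p) p = (\<lambda>v. tderiv F p v - tderiv G p v)"
  using tderiv_add[OF assms(1) smooth_torus_minus[OF assms(2)]] tderiv_minus[OF assms(2)] by simp

lemma tderiv_Pair:
  fixes F G :: "torus \<Rightarrow> real"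
  assumes "smooth_torus F" "smooth_torus G"
  shows "tderiv (\<lambda>p. (F p, G p)) p = (\<lambda>v. (tderiv F p v, tderiv G p v))"
  by (cases p rule: Phi_cases)
    (auto intro!: tderiv_eqI has_derivative_Pair has_derivative_tderiv assms)

lemma tderiv_eq_pd:
  fixes F :: "torus \<Rightarrow> real"
  assumes "smooth_torus F"
  shows "tderiv F p v = fst v * pd1 F p + snd v * pd2 F p"
proof -
  obtain x where p: "p = Phi x" using Phi_surj_square by blast
  have l: "linear (tderiv F p)"
    using has_derivative_linear[OF has_derivative_tderiv[OF assms]] p by blast
  have "v = fst v *\<^sub>R (1, 0) + snd v *\<^sub>R (0, 1)"
    by (simp add: prod_eq_iff)
  then have "tderiv F p v = tderiv F p (fst v *\<^sub>R (1, 0) + snd v *\<^sub>R (0, 1))"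
    by simp
  also have "\<dots> = fst v * pd1 F p + snd v * pd2 F p"
    by (simp only: linear_add[OF l] linear_scale[OF l] pd1_def pd2_def real_scaleR_def)
  finally show ?thesis .
qed

lemma pd_commute:
  fixes F :: "torus \<Rightarrow> real"
  assumes "smooth_torus F"
  shows "pd1 (pd2 F) p = pd2 (pd1 F) p"
proof -
  obtain x where p: "p = Phi x" using Phi_surj_square by blast
  show ?thesis
    using frechet_derivative_commute[of "F \<circ> Phi" x] assms
    unfolding p smooth_torus_def pd1_def pd2_def tderiv_Phi o_def by simp
qed

lemma DERIV_pd1:
  fixes F :: "torus \<Rightarrow> real"
  shows "smooth_torus F \<Longrightarrow>
    ((\<lambda>t. F (Phi (t, s))) has_real_derivative pd1 F (Phi (t, s))) (at t within S)"
  using DERIV_fst[OF smooth_torus_differentiable] by (simp add: pd1_def tderiv_Phi)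

lemma DERIV_pd2:
  fixes F :: "torus \<Rightarrow> real"
  shows "smooth_torus F \<Longrightarrow>
    ((\<lambda>s. F (Phi (t, s))) has_real_derivative pd2 F (Phi (t, s))) (at s within S)"
  using DERIV_snd[OF smooth_torus_differentiable] by (simp add: pd2_def tderiv_Phi)

section \<open>Hamiltonian vector fields and their potentials\<close>

definition poisson :: "(torus \<Rightarrow> real) \<Rightarrow> (torus \<Rightarrow> real) \<Rightarrow> torus \<Rightarrow> real" where
  "poisson f g p = pd1 f p * pd2 g p - pd2 f p * pd1 g p"

lemma smooth_torus_poisson: "smooth_torus f \<Longrightarrow> smooth_torus g \<Longrightarrow> smooth_torus (poisson f g)"
  unfolding poisson_def by (intro smooth_torus_intros)

text \<open>Both components are the product rule plus the symmetry of mixed partial derivatives. The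
  bracket thereby gets an explicit Hamiltonian, which is what the cocycle identity and the
  coboundary computation work with.\<close>

lemma lie_bracket_ham_vf:
  assumes f: "smooth_torus f" and g: "smooth_torus g"
  shows "lie_bracket (ham_vf f) (ham_vf g) = ham_vf (poisson f g)"
proof
  fix p
  note sm = f g smooth_torus_pd1[OF f] smooth_torus_pd2[OF f] smooth_torus_pd1[OF g] smooth_torus_pd2[OF g]
  have D: "tderiv (ham_vf h) p v = (- (fst v * pd1 (pd2 h) p + snd v * pd2 (pd2 h) p),
      fst v * pd1 (pd1 h) p + snd v * pd2 (pd1 h) p)" if "smooth_torus h" for h v
    unfolding ham_vf_def using that
    by (simp add: tderiv_Pair tderiv_minus tderiv_eq_pd smooth_torus_intros)
  have pd: "pd1 (poisson f g) p = pd1 f p * pd1 (pd2 g) p + pd1 (pd1 f) p * pd2 g p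
        - (pd2 f p * pd1 (pd1 g) p + pd1 (pd2 f) p * pd1 g p)"
      "pd2 (poisson f g) p = pd1 f p * pd2 (pd2 g) p + pd2 (pd1 f) p * pd2 g p
        - (pd2 f p * pd2 (pd1 g) p + pd2 (pd2 f) p * pd1 g p)"
    unfolding pd1_def[of "poisson f g"] pd2_def[of "poisson f g"] poisson_def
    by (simp_all add: sm tderiv_diff tderiv_mult smooth_torus_mult flip: pd1_def pd2_def)
  show "lie_bracket (ham_vf f) (ham_vf g) p = ham_vf (poisson f g) p"
    unfolding lie_bracket_def D[OF f] D[OF g]
    by (simp add: ham_vf_def pd pd_commute f g algebra_simps)
qed

lemma ham_vf_lincomb:
  assumes "smooth_torus f" "smooth_torus g"
  shows "ham_vf (\<lambda>p. a * f p + b * g p) = (\<lambda>p. a *\<^sub>R ham_vf f p + b *\<^sub>R ham_vf g p)"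
  using assms
  by (simp add: ham_vf_def fun_eq_iff pd1_def pd2_def tderiv_add tderiv_scale smooth_torus_scale)

lemma ham_vf_in_ham_alg: "smooth_torus f \<Longrightarrow> ham_vf f \<in> ham_alg"
  by (auto simp: ham_alg_def)

lemma ham_alg_lincomb:
  assumes "X \<in> ham_alg" "Y \<in> ham_alg"
  shows "(\<lambda>p. a *\<^sub>R X p + b *\<^sub>R Y p) \<in> ham_alg"
proof -
  obtain f g where "smooth_torus f" "X = ham_vf f" "smooth_torus g" "Y = ham_vf g"
    using assms by (auto simp: ham_alg_def)
  then show ?thesis
    using ham_vf_lincomb[of f g a b] ham_vf_in_ham_alg[of "\<lambda>p. a * f p + b * g p"]
    by (simp add: smooth_torus_intros)
qed

lemma ham_alg_diff: "X \<in> ham_alg \<Longrightarrow> Y \<in> ham_alg \<Longrightarrow> (\<lambda>p. X p - Y p) \<in> ham_alg"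
  using ham_alg_lincomb[of X Y 1 "-1"] by simp

text \<open>The gradient of \<open>f\<close> is its Hamiltonian field turned by a right angle, so it
  has the same length, and the mean value inequality applies on the plane. Every point has a
  preimage in the square of side 2 pi, at distance at most 4 pi from the origin. The estimate gives
  continuity of the cocycles and, with \<open>B = 0\<close>, uniqueness of potentials.\<close>

lemma potential_bound:
  assumes f: "smooth_torus f" and B: "\<And>p. norm (ham_vf f p) \<le> B"
  shows "\<bar>f p - f (Phi (0, 0))\<bar> \<le> B * (4 * pi)"
proof -
  obtain x where x: "x \<in> cbox (0, 0) (2*pi, 2*pi)" and p: "p = Phi x"
    using Phi_surj_square by blast
  have "B \<ge> 0" using norm_ge_zero order_trans B by blast
  have "norm (f (Phi x) - f (Phi (0, 0))) \<le> B * norm (x - (0, 0))"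
  proof (rule differentiable_bound[of UNIV])
    show "((\<lambda>x. f (Phi x)) has_derivative tderiv f (Phi y)) (at y within UNIV)" for y
      using has_derivative_tderiv[OF f] by blast
    show "onorm (tderiv f (Phi y)) \<le> B" for y
    proof (rule onorm_le)
      fix v
      have "norm (tderiv f (Phi y) v) = norm (v \<bullet> (pd1 f (Phi y), pd2 f (Phi y)))"
        by (cases v) (simp add: tderiv_eq_pd f)
      also have "\<dots> \<le> norm v * norm (pd1 f (Phi y), pd2 f (Phi y))"
        by (simp add: Cauchy_Schwarz_ineq2)
      also have "norm (pd1 f (Phi y), pd2 f (Phi y)) = norm (ham_vf f (Phi y))"
        by (simp add: ham_vf_def norm_Pair add.commute)
      also have "norm v * \<dots> \<le> norm v * B"
        using B by (intro mult_left_mono) auto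
      finally show "norm (tderiv f (Phi y) v) \<le> B * norm v"
        by (simp add: mult.commute)
    qed
  qed auto
  also have "norm (x - (0, 0)) \<le> 4 * pi"
    using x norm_Pair_le[of "fst x" "snd x"] by (cases x) (auto simp: cbox_Pair_eq)
  finally show ?thesis
    using \<open>B \<ge> 0\<close> p mult_left_mono by fastforce
qed

text \<open>Fixing the value at one point removes the free constant; as this condition is linear,
  the potential depends linearly on the field.\<close>

definition potential :: "vfield \<Rightarrow> torus \<Rightarrow> real" where
  "potential X = (SOME f. smooth_torus f \<and> ham_vf f = X \<and> f (Phi (0, 0)) = 0)"

lemma ham_vf_shift: "smooth_torus f \<Longrightarrow> ham_vf (\<lambda>p. f p - c) = ham_vf f"
  by (simp add: ham_vf_def fun_eq_iff pd1_def pd2_def tderiv_diff smooth_torus_const tderiv_const)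

lemma
  assumes "X \<in> ham_alg"
  shows smooth_torus_potential: "smooth_torus (potential X)"
    and ham_vf_potential: "ham_vf (potential X) = X"
    and potential_base: "potential X (Phi (0, 0)) = 0"
proof -
  obtain f where f: "smooth_torus f" "X = ham_vf f"
    using assms by (auto simp: ham_alg_def)
  have "\<exists>f. smooth_torus f \<and> ham_vf f = X \<and> f (Phi (0, 0)) = 0"
    by (rule exI[of _ "\<lambda>p. f p - f (Phi (0, 0))"])
      (simp add: f ham_vf_shift smooth_torus_intros)
  from someI_ex[OF this] show "smooth_torus (potential X)" "ham_vf (potential X) = X"
    "potential X (Phi (0, 0)) = 0"
    unfolding potential_def by auto
qed

text \<open>The difference of two such potentials has vanishing Hamiltonian field, so
  \<open>potential_bound\<close> with bound 0 makes it constant, and it is zero at the base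
  point.\<close>

lemma potential_eqI:
  assumes f: "smooth_torus f" "f (Phi (0, 0)) = 0" "ham_vf f = X"
  shows "potential X = f"
proof
  fix p
  have X: "X \<in> ham_alg" using f ham_vf_in_ham_alg by blast
  let ?h = "\<lambda>p. 1 * potential X p + (-1) * f p"
  have "smooth_torus ?h"
    using smooth_torus_potential[OF X] f by (intro smooth_torus_intros)
  moreover have "ham_vf ?h p = 0" for p
    using ham_vf_lincomb[OF smooth_torus_potential[OF X] f(1), of 1 "-1"] ham_vf_potential[OF X] f
    by simp
  ultimately show "potential X p = f p"
    using potential_bound[of ?h 0 p] potential_base[OF X] f by simp
qed

lemma potential_ham_vf: "smooth_torus f \<Longrightarrow> potential (ham_vf f) = (\<lambda>p. f p - f (Phi (0, 0)))"
  by (rule potential_eqI) (auto simp: ham_vf_shift smooth_torus_intros)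

lemma potential_lincomb:
  assumes "X \<in> ham_alg" "Y \<in> ham_alg"
  shows "potential (\<lambda>p. a *\<^sub>R X p + b *\<^sub>R Y p) = (\<lambda>p. a * potential X p + b * potential Y p)"
proof (rule potential_eqI)
  note S = assms[THEN smooth_torus_potential]
  show "smooth_torus (\<lambda>p. a * potential X p + b * potential Y p)"
    by (intro smooth_torus_add smooth_torus_scale S)
  show "ham_vf (\<lambda>p. a * potential X p + b * potential Y p) = (\<lambda>p. a *\<^sub>R X p + b *\<^sub>R Y p)"
    unfolding ham_vf_lincomb[OF S] ham_vf_potential[OF assms(1)] ham_vf_potential[OF assms(2)] ..
qed (simp add: potential_base assms)

section \<open>Continuous cochains\<close>

text \<open>The sup norm is one of the seminorms generating the topology. All cochains below are
  bounded by it, so no higher derivative has to be estimated.\<close>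

abbreviation vf_norm :: "vfield \<Rightarrow> real" where
  "vf_norm \<equiv> vf_seminorm 0 0"

text \<open>A supremum of reals is an upper bound only for a set bounded above; compactness of the
  square, which \<open>Phi\<close> maps onto the torus, supplies this.\<close>

lemma norm_le_vf_norm:
  assumes "X \<in> ham_alg"
  shows "norm (X p) \<le> vf_norm X"
proof -
  obtain f where f: "smooth_torus f" "X = ham_vf f"
    using assms by (auto simp: ham_alg_def)
  define K :: "(real \<times> real) set" where "K = cbox (0, 0) (2*pi, 2*pi)"
  have "continuous_on K (\<lambda>x. norm (X (Phi x)))"
    using smooth_torus_continuous[OF smooth_torus_pd1[OF f(1)], of K]
      smooth_torus_continuous[OF smooth_torus_pd2[OF f(1)], of K]
    unfolding f ham_vf_def o_def by (intro continuous_intros)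
  then have "compact ((\<lambda>x. norm (X (Phi x))) ` K)"
    unfolding K_def by (rule compact_continuous_image) auto
  moreover have "range (\<lambda>p. norm (X p)) \<subseteq> (\<lambda>x. norm (X (Phi x))) ` K"
  proof clarify
    show "norm (X p) \<in> (\<lambda>x. norm (X (Phi x))) ` K" for p
      using Phi_surj_square[of p] unfolding K_def by blast
  qed
  ultimately have "bdd_above (range (\<lambda>p. norm (X p)))"
    by (metis bdd_above_mono bounded_imp_bdd_above compact_imp_bounded)
  then show ?thesis
    unfolding vf_seminorm_def by (auto intro: cSUP_upper)
qed

lemma vf_norm_nonneg: "X \<in> ham_alg \<Longrightarrow> 0 \<le> vf_norm X"
  using norm_le_vf_norm norm_ge_zero order_trans by blast

definition vf_ball :: "vfield \<Rightarrow> real \<Rightarrow> vfield set" where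
  "vf_ball X e = {Y \<in> ham_alg. vf_norm (\<lambda>p. Y p - X p) < e}"

lemma openin_vf_ball: "X \<in> ham_alg \<Longrightarrow> e > 0 \<Longrightarrow> openin ham_topology (vf_ball X e)"
  unfolding ham_topology_def vf_ball_def by (rule topology_generated_by_Basis) blast

lemma centre_in_vf_ball: "X \<in> ham_alg \<Longrightarrow> e > 0 \<Longrightarrow> X \<in> vf_ball X e"
  by (simp add: vf_ball_def vf_seminorm_def)

lemma topspace_ham_topology: "topspace ham_topology \<subseteq> ham_alg"
  unfolding ham_topology_def topology_generated_by_topspace by auto

lemma openin_product_coordinate:
  assumes "openin T U" "i \<in> I"
  shows "openin (product_topology (\<lambda>_. T) I) {x \<in> topspace (product_topology (\<lambda>_. T) I). x i \<in> U}"
  using assms by (intro openin_continuous_map_preimage[OF continuous_map_product_projection])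

lemma continuous_map_euclideanrealI:
  fixes f :: "'a \<Rightarrow> real"
  assumes "\<And>x e. x \<in> topspace T \<Longrightarrow> e > 0 \<Longrightarrow> \<exists>U. openin T U \<and> x \<in> U \<and> (\<forall>y\<in>U. \<bar>f y - f x\<bar> < e)"
  shows "continuous_map T euclideanreal f"
  using Met_TC.continuous_map_to_metric[of T f] assms
  by (simp add: dist_real_def abs_minus_commute)

lemma tuples_1E:
  assumes "xs \<in> tuples 1"
  obtains X where "xs = [X]" "X \<in> ham_alg"
  using assms by (auto simp: tuples_def length_Suc_conv)

lemma tuples_2E:
  assumes "xs \<in> tuples 2"
  obtains X Y where "xs = [X, Y]" "X \<in> ham_alg" "Y \<in> ham_alg"
  using assms by (auto simp: tuples_def length_Suc_conv numeral_2_eq_2)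

lemma tuples_3E:
  assumes "xs \<in> tuples (Suc 2)"
  obtains X Y Z where "xs = [X, Y, Z]" "X \<in> ham_alg" "Y \<in> ham_alg" "Z \<in> ham_alg"
  using assms by (auto simp: tuples_def length_Suc_conv numeral_2_eq_2)

text \<open>A linear functional bounded by a single continuous seminorm is continuous: the preimage
  needed is a ball around the point in that seminorm.\<close>

lemma cochains_1I:
  fixes l :: "vfield \<Rightarrow> real"
  assumes lin: "\<And>X Y a b. X \<in> ham_alg \<Longrightarrow> Y \<in> ham_alg \<Longrightarrow>
      l (\<lambda>p. a *\<^sub>R X p + b *\<^sub>R Y p) = a * l X + b * l Y"
    and bd: "\<And>X. X \<in> ham_alg \<Longrightarrow> \<bar>l X\<bar> \<le> C * vf_norm X"
  shows "(\<lambda>xs. l (xs ! 0)) \<in> cochains 1"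
proof -
  have "multilinear 1 (\<lambda>xs. l (xs ! 0))"
    unfolding multilinear_def by (auto simp: lin simp del: One_nat_def elim!: tuples_1E)
  moreover have "alternating 1 (\<lambda>xs. l (xs ! 0))"
    by (auto simp: alternating_def)
  moreover have "continuous_cochain 1 (\<lambda>xs. l (xs ! 0))"
    unfolding continuous_cochain_def
  proof (rule continuous_map_euclideanrealI)
    fix x :: "nat \<Rightarrow> vfield" and e :: real
    define P where "P = product_topology (\<lambda>_::nat. ham_topology) {..<1}"
    assume "x \<in> topspace (product_topology (\<lambda>_. ham_topology) {..<1})" and e: "e > 0"
    then have x: "x \<in> topspace P" and X: "x 0 \<in> ham_alg"
      using topspace_ham_topology by (auto simp: P_def)
    \<comment> \<open>Adding 1 keeps the denominator positive whatever \<open>C\<close> is, and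
      makes the final estimate strict.\<close>
    define \<delta> where "\<delta> = e / (\<bar>C\<bar> + 1)"
    have \<delta>: "\<delta> > 0" using e by (simp add: \<delta>_def)
    define U where "U = {y \<in> topspace P. y 0 \<in> vf_ball (x 0) \<delta>}"
    have "openin P U"
      unfolding U_def P_def by (rule openin_product_coordinate) (auto simp: X \<delta> openin_vf_ball)
    moreover have "x \<in> U"
      using x by (simp add: U_def centre_in_vf_ball X \<delta>)
    moreover have "\<bar>l (map y [0..<1] ! 0) - l (map x [0..<1] ! 0)\<bar> < e" if "y \<in> U" for y
    proof -
      have y: "y 0 \<in> ham_alg" "vf_norm (\<lambda>p. y 0 p - x 0 p) < \<delta>"
        using that by (auto simp: U_def vf_ball_def)
      note D = ham_alg_diff[OF y(1) X]
      have "l (\<lambda>p. y 0 p - x 0 p) = l (y 0) - l (x 0)"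
        using lin[OF y(1) X, of 1 "-1"] by simp
      then have "\<bar>l (y 0) - l (x 0)\<bar> \<le> C * vf_norm (\<lambda>p. y 0 p - x 0 p)"
        using bd[OF D] by simp
      also have "\<dots> \<le> (\<bar>C\<bar> + 1) * vf_norm (\<lambda>p. y 0 p - x 0 p)"
        using vf_norm_nonneg[OF D] by (intro mult_right_mono) auto
      also have "\<dots> < (\<bar>C\<bar> + 1) * \<delta>"
        using y by (intro mult_strict_left_mono) auto
      finally show ?thesis
        by (simp add: \<delta>_def add_nonneg_eq_0_iff)
    qed
    ultimately show "\<exists>U. openin (product_topology (\<lambda>_. ham_topology) {..<1}) U \<and> x \<in> U \<and>
        (\<forall>y\<in>U. \<bar>l (map y [0..<1] ! 0) - l (map x [0..<1] ! 0)\<bar> < e)"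
      unfolding P_def by blast
  qed
  ultimately show ?thesis by (simp add: cochains_def)
qed

lemma cochains_2I:
  fixes \<beta> :: "vfield \<Rightarrow> vfield \<Rightarrow> real"
  assumes linl: "\<And>X Y Z a b. X \<in> ham_alg \<Longrightarrow> Y \<in> ham_alg \<Longrightarrow> Z \<in> ham_alg \<Longrightarrow>
      \<beta> (\<lambda>p. a *\<^sub>R X p + b *\<^sub>R Y p) Z = a * \<beta> X Z + b * \<beta> Y Z"
    and linr: "\<And>X Y Z a b. X \<in> ham_alg \<Longrightarrow> Y \<in> ham_alg \<Longrightarrow> Z \<in> ham_alg \<Longrightarrow>
      \<beta> Z (\<lambda>p. a *\<^sub>R X p + b *\<^sub>R Y p) = a * \<beta> Z X + b * \<beta> Z Y"
    and alt: "\<And>X. X \<in> ham_alg \<Longrightarrow> \<beta> X X = 0"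
    and bd: "\<And>X Y. X \<in> ham_alg \<Longrightarrow> Y \<in> ham_alg \<Longrightarrow> \<bar>\<beta> X Y\<bar> \<le> C * vf_norm X * vf_norm Y"
    and C: "C \<ge> 0"
  shows "(\<lambda>xs. \<beta> (xs ! 0) (xs ! 1)) \<in> cochains 2"
proof -
  have "multilinear 2 (\<lambda>xs. \<beta> (xs ! 0) (xs ! 1))"
    unfolding multilinear_def
    by (auto simp: linl linr less_2_cases_iff elim!: tuples_2E)
  moreover have "alternating 2 (\<lambda>xs. \<beta> (xs ! 0) (xs ! 1))"
    by (auto simp: alternating_def alt less_2_cases_iff elim!: tuples_2E)
  moreover have "continuous_cochain 2 (\<lambda>xs. \<beta> (xs ! 0) (xs ! 1))"
    unfolding continuous_cochain_def
  proof (rule continuous_map_euclideanrealI)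
    fix x :: "nat \<Rightarrow> vfield" and e :: real
    define P where "P = product_topology (\<lambda>_::nat. ham_topology) {..<2}"
    assume "x \<in> topspace (product_topology (\<lambda>_. ham_topology) {..<2})" and e: "e > 0"
    then have x: "x \<in> topspace P"
      by (simp add: P_def)
    then have X: "x 0 \<in> ham_alg" "x 1 \<in> ham_alg"
      using topspace_ham_topology by (auto simp: P_def PiE_iff)
    \<comment> \<open>With \<open>D i\<close> the increments, the difference of values is \<beta>(D
      0, D 1) + \<beta>(D 0, x 1) + \<beta>(x 0, D 1). The summands in the bracket bound these three
      terms in turn, the quadratic one because \<delta> is at most 1; the final 1 leaves a spare
      \<delta> that makes the bound strict.\<close>
    define K where "K = C * (1 + vf_norm (x 0) + vf_norm (x 1)) + 1"
    have K: "K \<ge> 1"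
      using C X vf_norm_nonneg by (simp add: K_def)
    define \<delta> where "\<delta> = min 1 (e / K)"
    have \<delta>: "\<delta> > 0" "\<delta> \<le> 1" "K * \<delta> \<le> e"
      using e K by (auto simp: \<delta>_def field_simps min_def)
    define U where "U = {y \<in> topspace P. y 0 \<in> vf_ball (x 0) \<delta>} \<inter> {y \<in> topspace P. y 1 \<in> vf_ball (x 1) \<delta>}"
    have "openin P U"
      unfolding U_def P_def
      by (intro openin_Int openin_product_coordinate) (use X in \<open>auto simp: \<delta> openin_vf_ball\<close>)
    moreover have "x \<in> U"
      using x X by (simp add: U_def centre_in_vf_ball \<delta>)
    moreover have "\<bar>\<beta> (map y [0..<2] ! 0) (map y [0..<2] ! 1)
        - \<beta> (map x [0..<2] ! 0) (map x [0..<2] ! 1)\<bar> < e" if "y \<in> U" for y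
    proof -
      define D where "D i = (\<lambda>p. y i p - x i p)" for i
      have y: "y 0 \<in> ham_alg" "y 1 \<in> ham_alg" "vf_norm (D 0) \<le> \<delta>" "vf_norm (D 1) \<le> \<delta>"
        using that by (auto simp: U_def vf_ball_def D_def)
      have D: "D 0 \<in> ham_alg" "D 1 \<in> ham_alg"
        using X y ham_alg_diff by (auto simp: D_def)
      have l: "\<beta> (D 0) Z = \<beta> (y 0) Z - \<beta> (x 0) Z" if "Z \<in> ham_alg" for Z
        using linl[OF y(1) X(1) that, of 1 "-1"] by (simp add: D_def)
      have r: "\<beta> Z (D 1) = \<beta> Z (y 1) - \<beta> Z (x 1)" if "Z \<in> ham_alg" for Z
        using linr[OF y(2) X(2) that, of 1 "-1"] by (simp add: D_def)
      have "\<beta> (y 0) (y 1) - \<beta> (x 0) (x 1) = \<beta> (D 0) (D 1) + \<beta> (D 0) (x 1) + \<beta> (x 0) (D 1)"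
        unfolding l[OF D(2)] l[OF X(2)] r[OF X(1)] r[OF y(1)] by simp
      moreover have "\<bar>\<beta> (D 0) (D 1)\<bar> \<le> C * \<delta>"
      proof -
        have "\<bar>\<beta> (D 0) (D 1)\<bar> \<le> C * vf_norm (D 0) * vf_norm (D 1)"
          by (rule bd[OF D])
        also have "\<dots> \<le> C * \<delta> * 1"
          using y C \<delta> vf_norm_nonneg[OF D(1)] vf_norm_nonneg[OF D(2)] by (intro mult_mono) auto
        finally show ?thesis by simp
      qed
      moreover have "\<bar>\<beta> (D 0) (x 1)\<bar> \<le> C * vf_norm (x 1) * \<delta>"
      proof -
        have "\<bar>\<beta> (D 0) (x 1)\<bar> \<le> C * vf_norm (D 0) * vf_norm (x 1)"
          by (rule bd[OF D(1) X(2)])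
        also have "\<dots> \<le> C * \<delta> * vf_norm (x 1)"
          using y C vf_norm_nonneg[OF D(1)] vf_norm_nonneg[OF X(2)] by (intro mult_mono) auto
        finally show ?thesis by (simp add: ac_simps)
      qed
      moreover have "\<bar>\<beta> (x 0) (D 1)\<bar> \<le> C * vf_norm (x 0) * \<delta>"
      proof -
        have "\<bar>\<beta> (x 0) (D 1)\<bar> \<le> C * vf_norm (x 0) * vf_norm (D 1)"
          by (rule bd[OF X(1) D(2)])
        also have "\<dots> \<le> C * vf_norm (x 0) * \<delta>"
          using y C vf_norm_nonneg[OF D(2)] vf_norm_nonneg[OF X(1)] by (intro mult_mono) auto
        finally show ?thesis .
      qed
      ultimately have "\<bar>\<beta> (y 0) (y 1) - \<beta> (x 0) (x 1)\<bar> \<le> C * \<delta> + C * vf_norm (x 1) * \<delta> + C * vf_norm (x 0) * \<delta>"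
        by linarith
      also have "\<dots> = K * \<delta> - \<delta>"
        by (simp add: K_def algebra_simps)
      also have "\<dots> < e" using \<delta> by simp
      finally show ?thesis by simp
    qed
    ultimately show "\<exists>U. openin (product_topology (\<lambda>_. ham_topology) {..<2}) U \<and> x \<in> U \<and>
        (\<forall>y\<in>U. \<bar>\<beta> (map y [0..<2] ! 0) (map y [0..<2] ! 1)
          - \<beta> (map x [0..<2] ! 0) (map x [0..<2] ! 1)\<bar> < e)"
      unfolding P_def by blast
  qed
  ultimately show ?thesis by (simp add: cochains_def)
qed

section \<open>The differential of 1-cochains and of 2-cochains\<close>

lemma ce_diff_2: "ce_diff \<mu> [X, Y] = - \<mu> [lie_bracket X Y]"
proof -
  have "{(i, j). i < j \<and> j < length [X, Y]} = {(0, 1)}" by auto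
  then show ?thesis by (simp add: ce_diff_def nths_Cons)
qed

lemma ce_diff_3:
  "ce_diff \<mu> [X, Y, Z] = - \<mu> [lie_bracket X Y, Z] + \<mu> [lie_bracket X Z, Y] - \<mu> [lie_bracket Y Z, X]"
proof -
  have "{(i, j). i < j \<and> j < length [X, Y, Z]} = {(0, 1), (0, 2), (1, 2)}" by auto
  then show ?thesis by (simp add: ce_diff_def nths_Cons)
qed

section \<open>The cocycle of an invariant functional\<close>

text \<open>\<open>L_pd1\<close> is the infinitesimal form of invariance under translations in t. It
  does the work of well-definedness and of alternation, while \<open>L_bound\<close> gives
  continuity. Proving the cocycle property at this level settles both cocycles of the theorem at
  once.\<close>

locale invariant_functional =
  fixes L :: "(torus \<Rightarrow> real) \<Rightarrow> real" and C :: real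
  assumes L_lincomb: "\<And>f g a b. smooth_torus f \<Longrightarrow> smooth_torus g \<Longrightarrow>
      L (\<lambda>p. a * f p + b * g p) = a * L f + b * L g"
    and L_bound: "\<And>f B. smooth_torus f \<Longrightarrow> (\<And>p. \<bar>f p\<bar> \<le> B) \<Longrightarrow> \<bar>L f\<bar> \<le> C * B"
    and L_pd1: "\<And>f. smooth_torus f \<Longrightarrow> L (pd1 f) = 0"
begin

definition omega :: "vfield \<Rightarrow> vfield \<Rightarrow> real" where
  "omega X Y = L (\<lambda>p. potential X p * pd1 (potential Y) p)"

lemma C_nonneg: "C \<ge> 0"
  using L_bound[OF smooth_torus_const, of 0 1] by simp

text \<open>Normalising \<open>f\<close> subtracts a constant, which changes the argument of
  \<open>L\<close> by a multiple of \<open>pd1 g\<close>, and \<open>L\<close> kills that;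
  normalising \<open>g\<close> does not affect \<open>pd1 g\<close>. So any Hamiltonian may be
  used.\<close>

lemma omega_ham_vf:
  assumes f: "smooth_torus f" and g: "smooth_torus g"
  shows "omega (ham_vf f) (ham_vf g) = L (\<lambda>p. f p * pd1 g p)"
proof -
  have "pd1 (\<lambda>p. g p - g (Phi (0, 0))) = pd1 g"
    by (simp add: fun_eq_iff pd1_def tderiv_diff tderiv_const smooth_torus_const g)
  then have "omega (ham_vf f) (ham_vf g) = L (\<lambda>p. 1 * (f p * pd1 g p) + (- f (Phi (0, 0))) * pd1 g p)"
    by (simp add: omega_def potential_ham_vf f g algebra_simps)
  also have "\<dots> = L (\<lambda>p. f p * pd1 g p)"
    using f g by (subst L_lincomb) (auto simp: L_pd1 intro: smooth_torus_intros)
  finally show ?thesis .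
qed

text \<open>For the continuity bound each argument contributes one sup norm:
  \<open>potential_bound\<close> controls the potential of X, at the cost of the factor 4 pi, and
  the t-derivative of the potential of Y is the second component of Y.\<close>

lemma omega_in_cochains: "(\<lambda>xs. omega (xs ! 0) (xs ! 1)) \<in> cochains 2"
proof (rule cochains_2I[where C="C * (4 * pi)"])
  fix X Y Z a b
  assume A: "X \<in> ham_alg" "Y \<in> ham_alg" "Z \<in> ham_alg"
  note S = A[THEN smooth_torus_potential]
  have "omega (\<lambda>p. a *\<^sub>R X p + b *\<^sub>R Y p) Z =
      L (\<lambda>p. a * (potential X p * pd1 (potential Z) p) + b * (potential Y p * pd1 (potential Z) p))"
    by (simp add: omega_def potential_lincomb A algebra_simps)
  then show "omega (\<lambda>p. a *\<^sub>R X p + b *\<^sub>R Y p) Z = a * omega X Z + b * omega Y Z"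
    using S by (simp add: omega_def L_lincomb smooth_torus_intros)
  have "pd1 (\<lambda>p. a * potential X p + b * potential Y p)
      = (\<lambda>p. a * pd1 (potential X) p + b * pd1 (potential Y) p)"
    using S by (simp add: fun_eq_iff pd1_def tderiv_add tderiv_scale smooth_torus_scale)
  then have "omega Z (\<lambda>p. a *\<^sub>R X p + b *\<^sub>R Y p) =
      L (\<lambda>p. a * (potential Z p * pd1 (potential X) p) + b * (potential Z p * pd1 (potential Y) p))"
    by (simp add: omega_def potential_lincomb A algebra_simps)
  then show "omega Z (\<lambda>p. a *\<^sub>R X p + b *\<^sub>R Y p) = a * omega Z X + b * omega Z Y"
    using S by (simp add: omega_def L_lincomb smooth_torus_intros)
next
  fix X assume "X \<in> ham_alg"
  define f where "f = potential X"
  have f: "smooth_torus f"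
    using \<open>X \<in> ham_alg\<close> by (simp add: f_def smooth_torus_potential)
  \<comment> \<open>Alternation: twice \<open>f * pd1 f\<close> is the derivative of the square of
    \<open>f\<close>. The factors 1 bring the sum into the shape of
    \<open>L_lincomb\<close>.\<close>
  have "pd1 (\<lambda>p. f p * f p) = (\<lambda>p. 1 * (f p * pd1 f p) + 1 * (f p * pd1 f p))"
    using f by (simp add: fun_eq_iff pd1_def tderiv_mult)
  then have "L (\<lambda>p. 1 * (f p * pd1 f p) + 1 * (f p * pd1 f p)) = 0"
    using L_pd1[OF smooth_torus_mult[OF f f]] by simp
  then show "omega X X = 0"
    using f by (subst (asm) L_lincomb) (auto simp: omega_def f_def intro: smooth_torus_intros)
next
  fix X Y assume A: "X \<in> ham_alg" "Y \<in> ham_alg"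
  note S = A[THEN smooth_torus_potential]
  have "\<bar>potential X p * pd1 (potential Y) p\<bar> \<le> vf_norm X * (4 * pi) * vf_norm Y" for p
  proof -
    have "\<bar>potential X p\<bar> \<le> vf_norm X * (4 * pi)"
      using potential_bound[OF S(1), of "vf_norm X" p] norm_le_vf_norm[OF A(1)]
      by (simp add: A ham_vf_potential potential_base)
    moreover have "\<bar>pd1 (potential Y) p\<bar> \<le> vf_norm Y"
    proof -
      have "\<bar>pd1 (potential Y) p\<bar> = norm (snd (Y p))"
        using ham_vf_potential[OF A(2)] by (metis ham_vf_def real_norm_def snd_conv)
      also have "\<dots> \<le> norm (Y p)"
        by (metis norm_snd_le prod.collapse)
      also have "\<dots> \<le> vf_norm Y"
        by (rule norm_le_vf_norm[OF A(2)])
      finally show ?thesis .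
    qed
    ultimately show ?thesis
      using vf_norm_nonneg[OF A(1)] by (auto simp: abs_mult intro!: mult_mono)
  qed
  from L_bound[OF _ this] S
  have "\<bar>omega X Y\<bar> \<le> C * (vf_norm X * (4 * pi) * vf_norm Y)"
    unfolding omega_def by (simp add: smooth_torus_intros)
  then show "\<bar>omega X Y\<bar> \<le> C * (4 * pi) * vf_norm X * vf_norm Y"
    by (simp add: algebra_simps)
qed (use C_nonneg in auto)

text \<open>The cocycle identity holds pointwise: the cyclic sum of \<open>{f, g} dh\<close> is the alternation of
  \<open>df \<and> dg \<otimes> dh\<close>, a 3-form in dimension 2.\<close>

lemma omega_cocycle: "(\<lambda>xs. omega (xs ! 0) (xs ! 1)) \<in> cocycles 2"
  unfolding cocycles_def
proof (safe intro!: omega_in_cochains elim!: tuples_3E)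
  fix X Y Z assume A: "X \<in> ham_alg" "Y \<in> ham_alg" "Z \<in> ham_alg"
  obtain f g h where S: "smooth_torus f" "smooth_torus g" "smooth_torus h"
    and e: "X = ham_vf f" "Y = ham_vf g" "Z = ham_vf h"
    using A by (auto simp: ham_alg_def)
  have "ce_diff (\<lambda>xs. omega (xs ! 0) (xs ! 1)) [X, Y, Z] = - L (\<lambda>p. poisson f g p * pd1 h p)
      + L (\<lambda>p. poisson f h p * pd1 g p) - L (\<lambda>p. poisson g h p * pd1 f p)"
    using S by (simp add: ce_diff_3 e lie_bracket_ham_vf omega_ham_vf smooth_torus_poisson)
  also have "L (\<lambda>p. poisson f h p * pd1 g p) =
      L (\<lambda>p. 1 * (poisson f g p * pd1 h p) + 1 * (poisson g h p * pd1 f p))"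
    by (rule arg_cong[of _ _ L]) (simp add: fun_eq_iff poisson_def algebra_simps)
  also have "\<dots> = L (\<lambda>p. poisson f g p * pd1 h p) + L (\<lambda>p. poisson g h p * pd1 f p)"
    using S by (subst L_lincomb) (auto intro!: smooth_torus_intros smooth_torus_poisson)
  finally show "ce_diff (\<lambda>xs. omega (xs ! 0) (xs ! 1)) [X, Y, Z] = 0"
    by simp
qed

end

section \<open>Integration over the torus and over the circle s = 0\<close>

abbreviation square :: "(real \<times> real) set" where
  "square \<equiv> cbox (0, 0) (2 * pi, 2 * pi)"

lemma integral_lincomb:
  fixes f g :: "'a::euclidean_space \<Rightarrow> real"
  assumes "f integrable_on S" "g integrable_on S"
  shows "integral S (\<lambda>x. a * f x + b * g x) = a * integral S f + b * integral S g"
  using assms by (intro integral_unique has_integral_add has_integral_mult_right) auto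

text \<open>Continuity on the compact closed square gives Lebesgue integrability, and the boundary
  has measure zero. The gauge integral over the closed square is the form to which Fubini and the
  fundamental theorem are applied below.\<close>

lemma torus_integral_eq:
  assumes "smooth_torus h"
  shows "torus_integral h = integral square (\<lambda>x. h (Phi x))"
proof -
  have box: "{0<..<2*pi} \<times> {0<..<2*pi} = box (0, 0) (2 * pi, 2 * pi :: real)"
    by (auto simp: box_def Basis_prod_def)
  have c: "continuous_on square (\<lambda>x. h (Phi x))"
    using smooth_torus_continuous[OF assms, of square] by (simp add: o_def)
  have "set_integrable lborel square (\<lambda>x. h (Phi x))"
    unfolding set_integrable_def by (rule borel_integrable_compact[OF compact_cbox c])
  then have "set_integrable lborel (box (0, 0) (2 * pi, 2 * pi)) (\<lambda>x. h (Phi x))"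
    by (rule set_integrable_subset) (auto simp: box_subset_cbox)
  then show ?thesis
    unfolding torus_integral_def box
    by (simp add: set_borel_integral_eq_integral(2) integral_open_interval)
qed

section \<open>Integration by parts over periods\<close>

lemma integral_pd1_eq_0:
  fixes f :: "torus \<Rightarrow> real"
  assumes "smooth_torus f"
  shows "integral {0..2*pi} (\<lambda>t. pd1 f (Phi (t, s))) = 0"
proof -
  have "((\<lambda>t. pd1 f (Phi (t, s))) has_integral f (Phi (2*pi, s)) - f (Phi (0, s))) {0..2*pi}"
    using DERIV_pd1[OF assms] by (intro fundamental_theorem_of_calculus)
      (auto simp flip: has_real_derivative_iff_has_vector_derivative)
  moreover have "Phi (2*pi, s) = Phi (0, s)"
    unfolding Phi_eq_iff by (auto intro: exI[of _ 1] exI[of _ 0])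
  ultimately show ?thesis
    by (simp add: integral_unique)
qed

lemma continuous_on_smooth_torus [continuous_intros]:
  assumes "smooth_torus h" "continuous_on S u"
  shows "continuous_on S (\<lambda>x. h (Phi (u x)))"
  using continuous_on_compose2[OF smooth_torus_continuous[OF assms(1), of UNIV] assms(2)]
  by simp

text \<open>A weight in s alone is a constant for the integration over a t-period, which is carried
  out first after exchanging the integrals. The case w = 1 gives invariance of
  \<open>area_mean\<close>; the case of \<open>weight\<close> discards the part of the Lie bracket
  that is a t-derivative.\<close>

lemma integral_square_weight_pd1:
  fixes f :: "torus \<Rightarrow> real"
  assumes f: "smooth_torus f" and w: "continuous_on UNIV w"
  shows "integral square (\<lambda>x. w (snd x) * pd1 f (Phi x)) = 0"
proof -
  have c: "continuous_on square (\<lambda>x. w (snd x) * pd1 f (Phi x))"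
    by (intro continuous_intros continuous_on_compose2[OF w] smooth_torus_pd1 f) auto
  have "integral square (\<lambda>x. w (snd x) * pd1 f (Phi x)) =
      integral {0..2*pi} (\<lambda>t. integral {0..2*pi} (\<lambda>s. w s * pd1 f (Phi (t, s))))"
    using integral_prod_continuous[OF c] by simp
  also have "\<dots> = integral {0..2*pi} (\<lambda>s. integral {0..2*pi} (\<lambda>t. w s * pd1 f (Phi (t, s))))"
    using integral_swap_continuous[of 0 0 "2*pi" "2*pi" "\<lambda>t s. w s * pd1 f (Phi (t, s))"] c
    by (simp add: split_beta)
  also have "\<dots> = 0"
    by (simp add: integral_pd1_eq_0 f)
  finally show ?thesis .
qed

text \<open>The weight \<open>s\<^sup>2/2 - \<pi>s\<close> has second derivative 1, vanishes at both ends of the period, and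
  its derivative jumps by \<open>2\<pi>\<close> there: this produces the difference of the two means.\<close>

definition weight :: "real \<Rightarrow> real" where
  "weight s = s * (s / 2 - pi)"

lemma continuous_on_weight [continuous_intros]:
  "continuous_on S u \<Longrightarrow> continuous_on S (\<lambda>x. weight (u x))"
  unfolding weight_def by (intro continuous_intros) auto

lemma integral_weight_pd2_pd2:
  fixes k :: "torus \<Rightarrow> real"
  assumes k: "smooth_torus k"
  shows "integral {0..2*pi} (\<lambda>s. weight s * pd2 (pd2 k) (Phi (t, s)) - k (Phi (t, s))) =
    - (2 * pi * k (Phi (t, 0)))"
proof -
  \<comment> \<open>This is the boundary term of two integrations by parts; \<open>s - pi\<close> is
    the derivative of \<open>weight\<close>. At the ends of the period only the second summand
    survives, with values - pi k and pi k.\<close>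
  define A where "A s = weight s * pd2 k (Phi (t, s)) - (s - pi) * k (Phi (t, s))" for s
  have "(A has_real_derivative weight s * pd2 (pd2 k) (Phi (t, s)) - k (Phi (t, s))) (at s within S)"
    for s S
    unfolding A_def weight_def
    by (auto intro!: derivative_eq_intros DERIV_pd2[OF k] DERIV_pd2[OF smooth_torus_pd2[OF k]]
        simp: algebra_simps)
  then have "((\<lambda>s. weight s * pd2 (pd2 k) (Phi (t, s)) - k (Phi (t, s))) has_integral A (2*pi) - A 0) {0..2*pi}"
    by (intro fundamental_theorem_of_calculus)
      (auto simp flip: has_real_derivative_iff_has_vector_derivative)
  moreover have "Phi (t, 2*pi) = Phi (t, 0)"
    unfolding Phi_eq_iff by (auto intro: exI[of _ 1] exI[of _ 0])
  ultimately show ?thesis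
    by (simp add: A_def weight_def integral_unique)
qed

text \<open>The factor is the coefficient of \<alpha>, since \<alpha>(X_g) = -1/(2 pi)
  \<open>pd1 g\<close>. Over a square of area 4 pi^2 this is -2 pi times the average of
  \<open>h\<close>.\<close>

definition area_mean :: "(torus \<Rightarrow> real) \<Rightarrow> real" where
  "area_mean h = - (1 / (2 * pi)) * integral square (\<lambda>x. h (Phi x))"

text \<open>The sign reflects the orientation of the circle against increasing t. Again the result
  is -2 pi times an average, now over the circle.\<close>

definition circle_mean :: "(torus \<Rightarrow> real) \<Rightarrow> real" where
  "circle_mean h = - integral {0..2*pi} (\<lambda>t. h (Phi (t, 0)))"

lemma norm_integral_square_le:
  fixes u :: "real \<times> real \<Rightarrow> real"
  assumes "continuous_on square u" "\<And>x. \<bar>u x\<bar> \<le> B"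
  shows "\<bar>integral square u\<bar> \<le> B * (4 * pi\<^sup>2)"
proof -
  have "norm (integral square u) \<le> B * measure lborel square"
  proof (rule has_integral_bound)
    show "0 \<le> B" using assms(2)[of 0] by linarith
    show "(u has_integral integral square u) square"
      using assms(1) integrable_continuous by blast
  qed (use assms in auto)
  moreover have "measure lborel square = 4 * pi\<^sup>2"
    by (simp add: content_Pair power2_eq_square)
  ultimately show ?thesis by simp
qed

interpretation area: invariant_functional area_mean "2 * pi"
proof
  fix f g :: "torus \<Rightarrow> real" and a b :: real
  assume "smooth_torus f" "smooth_torus g"
  then have "(\<lambda>x. f (Phi x)) integrable_on square" "(\<lambda>x. g (Phi x)) integrable_on square"
    by (auto intro!: integrable_continuous continuous_intros)
  then show "area_mean (\<lambda>p. a * f p + b * g p) = a * area_mean f + b * area_mean g"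
    unfolding area_mean_def by (subst integral_lincomb) (simp_all add: algebra_simps)
next
  fix f :: "torus \<Rightarrow> real" and B
  assume "smooth_torus f" "\<And>p. \<bar>f p\<bar> \<le> B"
  then have "\<bar>integral square (\<lambda>x. f (Phi x))\<bar> \<le> B * (4 * pi\<^sup>2)"
    by (intro norm_integral_square_le continuous_intros) auto
  then show "\<bar>area_mean f\<bar> \<le> 2 * pi * B"
    by (simp add: area_mean_def abs_mult field_simps power2_eq_square)
next
  fix f :: "torus \<Rightarrow> real"
  assume "smooth_torus f"
  then show "area_mean (pd1 f) = 0"
    using integral_square_weight_pd1[of f "\<lambda>_. 1"] by (simp add: area_mean_def)
qed

interpretation circle: invariant_functional circle_mean "2 * pi"
proof
  fix f g :: "torus \<Rightarrow> real" and a b :: real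
  assume "smooth_torus f" "smooth_torus g"
  then have "(\<lambda>t. f (Phi (t, 0))) integrable_on {0..2*pi}" "(\<lambda>t. g (Phi (t, 0))) integrable_on {0..2*pi}"
    by (auto intro!: integrable_continuous_interval continuous_intros)
  then show "circle_mean (\<lambda>p. a * f p + b * g p) = a * circle_mean f + b * circle_mean g"
    unfolding circle_mean_def by (subst integral_lincomb) (simp_all add: algebra_simps)
next
  fix f :: "torus \<Rightarrow> real" and B
  assume "smooth_torus f" "\<And>p. \<bar>f p\<bar> \<le> B"
  then have "norm (integral {0..2*pi} (\<lambda>t. f (Phi (t, 0)))) \<le> B * (2 * pi - 0)"
    by (intro integral_bound continuous_intros) auto
  then show "\<bar>circle_mean f\<bar> \<le> 2 * pi * B"
    by (simp add: circle_mean_def algebra_simps)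
next
  fix f :: "torus \<Rightarrow> real"
  assume "smooth_torus f"
  then show "circle_mean (pd1 f) = 0"
    by (simp add: circle_mean_def integral_pd1_eq_0)
qed

section \<open>The 1-cochain whose differential is the difference of the two cocycles\<close>

definition primitive :: "vfield \<Rightarrow> real" where
  "primitive X = 1 / (2 * pi) * integral square (\<lambda>x. weight (snd x) * fst (X (Phi x)))"

lemma continuous_on_ham_alg:
  assumes "X \<in> ham_alg"
  shows "continuous_on S (\<lambda>x. fst (X (Phi x)))"
proof -
  obtain f where "smooth_torus f" "X = ham_vf f"
    using assms by (auto simp: ham_alg_def)
  then show ?thesis
    by (auto simp: ham_vf_def intro!: continuous_intros smooth_torus_pd2)
qed

text \<open>As \<open>primitive\<close> is expressed through the field itself and not through a
  potential, linearity and the sup-norm bound are those of an integral with bounded weight.\<close>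

lemma primitive_in_cochains: "(\<lambda>xs. primitive (xs ! 0)) \<in> cochains 1"
proof (rule cochains_1I)
  fix X Y :: vfield and a b :: real
  assume "X \<in> ham_alg" "Y \<in> ham_alg"
  then have "(\<lambda>x. weight (snd x) * fst (X (Phi x))) integrable_on square"
      "(\<lambda>x. weight (snd x) * fst (Y (Phi x))) integrable_on square"
    by (auto intro!: integrable_continuous continuous_intros continuous_on_ham_alg)
  then have "integral square (\<lambda>x. a * (weight (snd x) * fst (X (Phi x))) + b * (weight (snd x) * fst (Y (Phi x))))
      = a * integral square (\<lambda>x. weight (snd x) * fst (X (Phi x)))
        + b * integral square (\<lambda>x. weight (snd x) * fst (Y (Phi x)))"
    by (rule integral_lincomb)
  then show "primitive (\<lambda>p. a *\<^sub>R X p + b *\<^sub>R Y p) = a * primitive X + b * primitive Y"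
    by (simp add: primitive_def algebra_simps)
next
  fix X assume X: "X \<in> ham_alg"
  \<comment> \<open>On the period the factors of \<open>weight\<close> are at most 2 pi and pi; the
    remaining 2 pi is the area 4 pi^2 divided by the normalisation 2 pi.\<close>
  show "\<bar>primitive X\<bar> \<le> (2 * pi * (2 * pi * pi)) * vf_norm X"
  proof -
    have "norm (integral square (\<lambda>x. weight (snd x) * fst (X (Phi x))))
        \<le> (2 * pi * pi * vf_norm X) * measure lborel square"
    proof (rule has_integral_bound)
      show "((\<lambda>x. weight (snd x) * fst (X (Phi x))) has_integral
          integral square (\<lambda>x. weight (snd x) * fst (X (Phi x)))) square"
        by (intro integrable_integral integrable_continuous continuous_intros
            continuous_on_ham_alg X)
      show "norm (weight (snd x) * fst (X (Phi x))) \<le> 2 * pi * pi * vf_norm X"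
        if "x \<in> square" for x
      proof -
        have "snd x \<in> {0..2*pi}"
          using that by (cases x) (auto simp: cbox_Pair_eq)
        then have "\<bar>weight (snd x)\<bar> \<le> 2 * pi * pi"
          unfolding weight_def abs_mult by (intro mult_mono) auto
        moreover have "\<bar>fst (X (Phi x))\<bar> \<le> vf_norm X"
          using norm_fst_le[of "fst (X (Phi x))" "snd (X (Phi x))"] norm_le_vf_norm[OF X, of "Phi x"]
          by simp
        ultimately show ?thesis
          unfolding real_norm_def abs_mult by (intro mult_mono) auto
      qed
    qed (use vf_norm_nonneg[OF X] in auto)
    then show ?thesis
      by (simp add: primitive_def abs_mult content_Pair field_simps)
  qed
qed

text \<open>The Poisson bracket is a divergence, \<open>pd1 m - pd2 k\<close>, because the mixed
  second derivatives of \<open>g\<close> cancel. The first component of the bracket is minus its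
  s-derivative, so after the t-derivative has integrated to zero only the second s-derivative of
  \<open>k\<close> meets the weight.\<close>

lemma primitive_lie_bracket:
  assumes f: "smooth_torus f" and g: "smooth_torus g"
  shows "primitive (lie_bracket (ham_vf f) (ham_vf g)) =
    circle_mean (\<lambda>p. f p * pd1 g p) - area_mean (\<lambda>p. f p * pd1 g p)"
proof -
  define k where "k = (\<lambda>p. f p * pd1 g p)"
  define m where "m = (\<lambda>p. f p * pd2 g p)"
  have k: "smooth_torus k" and m: "smooth_torus m"
    unfolding k_def m_def using f g by (auto intro: smooth_torus_intros)
  note g1 = smooth_torus_pd1[OF g] and g2 = smooth_torus_pd2[OF g]
  have "poisson f g p = pd1 m p - pd2 k p" for p
  proof -
    have "pd1 m p = f p * pd1 (pd2 g) p + pd1 f p * pd2 g p"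
      unfolding m_def pd1_def[of "\<lambda>p. f p * pd2 g p"]
      by (simp add: tderiv_mult f g2 flip: pd1_def)
    moreover have "pd2 k p = f p * pd2 (pd1 g) p + pd2 f p * pd1 g p"
      unfolding k_def pd2_def[of "\<lambda>p. f p * pd1 g p"]
      by (simp add: tderiv_mult f g1 flip: pd2_def)
    ultimately show ?thesis
      by (simp add: poisson_def pd_commute g)
  qed
  then have "poisson f g = (\<lambda>p. pd1 m p - pd2 k p)" by auto
  then have fst_eq: "fst (lie_bracket (ham_vf f) (ham_vf g) p) = pd2 (pd2 k) p - pd1 (pd2 m) p" for p
    unfolding lie_bracket_ham_vf[OF f g]
    using m k by (simp add: ham_vf_def pd2_def[of "\<lambda>p. pd1 m p - pd2 k p"] tderiv_diff
        smooth_torus_intros pd_commute flip: pd2_def)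
  have K: "integral square (\<lambda>x. weight (snd x) * pd2 (pd2 k) (Phi x) - k (Phi x))
      = 2 * pi * circle_mean k"
  proof -
    have "continuous_on square (\<lambda>x. weight (snd x) * pd2 (pd2 k) (Phi x) - k (Phi x))"
      by (intro continuous_intros smooth_torus_pd2 k)
    from integral_prod_continuous[OF this] show ?thesis
      by (simp add: integral_weight_pd2_pd2 k circle_mean_def)
  qed
  \<comment> \<open>Subtracting \<open>k\<close> turns the integrand into an exact s-derivative,
    which yields the circle term; the \<open>k\<close> added back yields the area term.\<close>
  define w1 where "w1 = (\<lambda>x. weight (snd x) * pd2 (pd2 k) (Phi x) - k (Phi x))"
  define w2 where "w2 = (\<lambda>x. weight (snd x) * pd1 (pd2 m) (Phi x))"
  have int: "w1 integrable_on square" "w2 integrable_on square" "(\<lambda>x. k (Phi x)) integrable_on square"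
    unfolding w1_def w2_def
    by (intro integrable_continuous continuous_intros smooth_torus_pd1 smooth_torus_pd2 k m)+
  have "integral square (\<lambda>x. weight (snd x) * fst (lie_bracket (ham_vf f) (ham_vf g) (Phi x)))
      = integral square (\<lambda>x. w1 x + k (Phi x) - w2 x)"
    by (simp add: fst_eq w1_def w2_def algebra_simps)
  also have "\<dots> = integral square w1 + integral square (\<lambda>x. k (Phi x)) - integral square w2"
    using int by (simp add: integral_add integral_diff integrable_add)
  also have "integral square w2 = 0"
    unfolding w2_def by (intro integral_square_weight_pd1 smooth_torus_pd2 m continuous_intros)
  finally have "primitive (lie_bracket (ham_vf f) (ham_vf g))
      = 1 / (2 * pi) * (2 * pi * circle_mean k + integral square (\<lambda>x. k (Phi x)))"
    unfolding primitive_def K[folded w1_def] by simp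
  then show ?thesis
    unfolding area_mean_def k_def[symmetric] by (simp add: field_simps)
qed

text \<open>The differential of a 1-cochain evaluates it on the bracket with a minus sign, which
  turns the circle-minus-area value of \<open>primitive\<close> into area minus circle.\<close>

lemma omega_diff_coboundary:
  "(\<lambda>xs. area.omega (xs ! 0) (xs ! 1) - circle.omega (xs ! 0) (xs ! 1)) \<in> coboundaries 2"
  unfolding coboundaries_def
proof (intro CollectI bexI ballI)
  fix xs assume "xs \<in> tuples 2"
  then obtain f g where "xs = [ham_vf f, ham_vf g]" "smooth_torus f" "smooth_torus g"
    by (auto elim!: tuples_2E simp: ham_alg_def)
  then show "area.omega (xs ! 0) (xs ! 1) - circle.omega (xs ! 0) (xs ! 1)
      = ce_diff (\<lambda>xs. primitive (xs ! 0)) xs"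
    by (simp add: ce_diff_2 primitive_lie_bracket area.omega_ham_vf circle.omega_ham_vf)
qed (use primitive_in_cochains in simp)

section \<open>The circle s = 0 as an oriented submanifold\<close>

definition zero_circle :: "torus set" where
  "zero_circle = {p. snd p = Abs_circle (cis 0)}"

text \<open>The direction of decreasing t matches the negative coefficient of \<alpha>: along it the
  form f dg reads - f \<open>pd1 g\<close> dt.\<close>

definition zero_orient :: vfield where
  "zero_orient = (\<lambda>_. (-1, 0))"

lemma Phi_in_zero_circle_iff: "Phi x \<in> zero_circle \<longleftrightarrow> Phi x = Phi (fst x, 0)"
  by (auto simp: zero_circle_def Phi_def)

lemma Phi_in_zero_circle [simp]: "Phi (t, 0) \<in> zero_circle"
  by (simp add: zero_circle_def Phi_def)

lemma continuous_on_Phi_line: "continuous_on S (\<lambda>t. Phi (t, 0))"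
  by (intro continuous_on_compose2[OF continuous_on_Phi] continuous_intros) auto

lemma zero_circle_eq: "zero_circle = (\<lambda>t. Phi (t, 0)) ` {0..2*pi}"
proof (intro equalityI subsetI)
  fix p assume p: "p \<in> zero_circle"
  obtain t where "t \<in> {0..2*pi}" "fst p = Abs_circle (cis t)"
    using Abs_circle_cis_surj by blast
  with p show "p \<in> (\<lambda>t. Phi (t, 0)) ` {0..2*pi}"
    by (intro image_eqI[of _ _ t]) (auto simp: zero_circle_def Phi_def prod_eq_iff)
qed (auto simp: zero_circle_def Phi_def)

lemma compact_zero_circle: "compact zero_circle"
  unfolding zero_circle_eq
  by (intro compact_continuous_image continuous_on_Phi_line) auto

lemma smooth_on_bounded_linear:
  assumes "bounded_linear f"
  shows "smooth_on S f"
proof -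
  have "frechet_derivative f (at x) = f" for x
    using bounded_linear_imp_has_derivative[OF assms] by (rule frechet_derivative_at[symmetric])
  moreover have "f differentiable (at x)" for x
    using assms by (rule bounded_linear_imp_differentiable)
  ultimately have "Ck_on k S f" for k
    using linear_continuous_on[OF assms] by (cases k) (auto simp: Ck_on_const)
  then show ?thesis by (simp add: smooth_on_def)
qed

text \<open>The angle runs backwards so that the velocity is exactly
  \<open>zero_orient\<close>.\<close>

definition zero_param :: "real \<Rightarrow> real \<times> real" where
  "zero_param t = (- t, 0)"

lemma vector_derivative_zero_param [simp]: "vector_derivative zero_param (at t) = (-1, 0)"
  unfolding zero_param_def
  by (intro vector_derivative_at) (auto intro!: derivative_eq_intros)

text \<open>The rotation moves the point with parameter \<open>c\<close>, the only one that the
  chart on the period starting at \<open>c\<close> misses, to -1 and so onto the branch cut of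
  \<open>Arg\<close>.\<close>

definition rotated :: "real \<Rightarrow> torus \<Rightarrow> complex" where
  "rotated c p = Rep_circle (fst p) * cis (c + pi)"

lemma continuous_on_rotated: "continuous_on S (rotated c)"
  unfolding rotated_def
  by (intro continuous_intros continuous_on_compose2[OF continuous_on_Rep_circle]) auto

lemma cis_notin_nonpos_Reals:
  assumes "- pi < x" "x < pi"
  shows "cis x \<notin> \<real>\<^sub>\<le>\<^sub>0"
proof
  assume "cis x \<in> \<real>\<^sub>\<le>\<^sub>0"
  then have "cos x \<le> 0" "sin x = 0"
    by (auto simp: complex_nonpos_Reals_iff)
  then show False
    using assms sin_eq_0_pi[of x] by simp
qed

text \<open>The point with parameter t is rotated to \<open>cis (c + pi - t)\<close>, and this angle
  runs through the open interval from - pi to pi exactly when t runs through the chart. So off the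
  branch cut \<open>Arg\<close> is continuous and recovers t.\<close>

lemma image_zero_param:
  "(Phi \<circ> zero_param) ` {c<..<c + 2 * pi} = zero_circle \<inter> rotated c -` (- \<real>\<^sub>\<le>\<^sub>0)" (is "?L = ?R")
  and homeomorphism_zero_param:
  "homeomorphism {c<..<c + 2 * pi} ((Phi \<circ> zero_param) ` {c<..<c + 2 * pi}) (Phi \<circ> zero_param)
     (\<lambda>p. c + pi - Arg (rotated c p))"
proof -
  have rot: "rotated c (Phi (zero_param t)) = cis (c + pi - t)" for t
    by (simp add: rotated_def Phi_def zero_param_def cis_mult algebra_simps)
  have sub: "?L \<subseteq> ?R"
  proof (intro image_subsetI IntI vimageI2 ComplI)
    fix t assume t: "t \<in> {c<..<c + 2 * pi}"
    show "(Phi \<circ> zero_param) t \<in> zero_circle"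
      by (simp add: zero_circle_def Phi_def zero_param_def)
    assume "rotated c ((Phi \<circ> zero_param) t) \<in> \<real>\<^sub>\<le>\<^sub>0"
    then show False
      using t cis_notin_nonpos_Reals[of "c + pi - t"] by (simp add: rot)
  qed
  have inv: "Phi (zero_param (c + pi - Arg (rotated c p))) = p"
    "c + pi - Arg (rotated c p) \<in> {c<..<c + 2 * pi}" if "p \<in> ?R" for p
  proof -
    define z where "z = rotated c p"
    have z: "norm z = 1" "z \<notin> \<real>\<^sub>\<le>\<^sub>0"
      using Rep_circle[of "fst p"] that by (auto simp: z_def rotated_def norm_mult)
    then have "cis (Arg z) = z"
      by (subst cis_Arg) (auto simp: sgn_div_norm)
    then have "cis (- (c + pi - Arg z)) = Rep_circle (fst p)"
      by (simp add: z_def rotated_def cis_mult flip: cis_divide)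
    then show "Phi (zero_param (c + pi - Arg (rotated c p))) = p"
      using that by (simp add: Phi_def zero_param_def zero_circle_def prod_eq_iff z_def Rep_circle_inverse)
    \<comment> \<open>\<open>Arg\<close> takes values in a half-open interval; excluding its closed
      end keeps the parameter strictly above \<open>c\<close>.\<close>
    have "Arg z \<noteq> pi"
      using z by (auto simp: Arg_eq_pi complex_nonpos_Reals_iff)
    then show "c + pi - Arg (rotated c p) \<in> {c<..<c + 2 * pi}"
      using Arg_bounded[of z] by (auto simp: z_def)
  qed
  show eq: "?L = ?R"
  proof (intro equalityI sub subsetI)
    show "p \<in> ?L" if "p \<in> ?R" for p
      by (rule image_eqI[OF _ inv(2)[OF that]]) (use inv(1)[OF that] in simp)
  qed
  show "homeomorphism {c<..<c + 2 * pi} ?L (Phi \<circ> zero_param) (\<lambda>p. c + pi - Arg (rotated c p))"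
  proof (rule homeomorphismI)
    show "continuous_on {c<..<c + 2 * pi} (Phi \<circ> zero_param)"
      unfolding o_def zero_param_def
      by (intro continuous_on_compose2[OF continuous_on_Phi] continuous_intros) auto
    show "continuous_on ?L (\<lambda>p. c + pi - Arg (rotated c p))"
      using sub by (intro continuous_intros continuous_on_rotated) auto
    show "c + pi - Arg (rotated c ((Phi \<circ> zero_param) t)) = t" if "t \<in> {c<..<c + 2 * pi}" for t
      using that by (simp add: rot Arg_cis)
  qed (use inv eq in auto)
qed

lemma local_param_zero_param: "local_param zero_circle c (c + 2 * pi) zero_param"
  unfolding local_param_def
proof (intro conjI)
  have "bounded_linear zero_param"
    unfolding zero_param_def by (intro bounded_linear_Pair bounded_linear_minus bounded_linear_ident bounded_linear_zero)
  then show "smooth_on {c<..<c + 2 * pi} zero_param"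
    by (rule smooth_on_bounded_linear)
  show "openin (top_of_set zero_circle) ((Phi \<circ> zero_param) ` {c<..<c + 2 * pi})"
    unfolding image_zero_param
    by (intro continuous_openin_preimage_gen continuous_on_rotated open_Compl closed_nonpos_Reals_complex)
  show "\<exists>v. homeomorphism {c<..<c + 2 * pi} ((Phi \<circ> zero_param) ` {c<..<c + 2 * pi}) (Phi \<circ> zero_param) v"
    using homeomorphism_zero_param by blast
qed (auto simp: zero_prod_def)

lemma pos_param_zero_param: "pos_param zero_circle zero_orient c (c + 2 * pi) zero_param"
  using local_param_zero_param by (simp add: pos_param_def zero_orient_def norm_Pair)

text \<open>The chart starting at 0 misses only the point 1, and the one starting at - pi, treated
  next, only the point -1; together they cover the circle. The end point is left as
  \<open>0 + 2 * pi\<close> to match \<open>image_zero_param\<close>.\<close>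

lemma Re_less_1_in_chart:
  assumes "p \<in> zero_circle" "Re (Rep_circle (fst p)) < 1"
  shows "p \<in> (Phi \<circ> zero_param) ` {0<..<0 + 2 * pi}"
proof -
  have "(Re (Rep_circle (fst p)))\<^sup>2 + (Im (Rep_circle (fst p)))\<^sup>2 = 1"
    using Rep_circle[of "fst p"] by (simp add: cmod_def)
  then have "Im (Rep_circle (fst p)) = 0 \<Longrightarrow> Re (Rep_circle (fst p)) = -1"
    using assms(2) by (simp add: power2_eq_1_iff)
  then show ?thesis
    unfolding image_zero_param using assms(1)
    by (auto simp: rotated_def complex_nonpos_Reals_iff)
qed

lemma Re_greater_minus_1_in_chart:
  assumes "p \<in> zero_circle" "- 1 < Re (Rep_circle (fst p))"
  shows "p \<in> (Phi \<circ> zero_param) ` {- pi<..<- pi + 2 * pi}"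
proof -
  have "(Re (Rep_circle (fst p)))\<^sup>2 + (Im (Rep_circle (fst p)))\<^sup>2 = 1"
    using Rep_circle[of "fst p"] by (simp add: cmod_def)
  then have "Im (Rep_circle (fst p)) = 0 \<Longrightarrow> Re (Rep_circle (fst p)) = 1"
    using assms(2) by (simp add: power2_eq_1_iff)
  then show ?thesis
    unfolding image_zero_param using assms(1)
    by (auto simp: rotated_def complex_nonpos_Reals_iff)
qed

lemma zero_circle_chart:
  assumes "p \<in> zero_circle"
  shows "\<exists>c. p \<in> (Phi \<circ> zero_param) ` {c<..<c + 2 * pi}"
  using Re_less_1_in_chart[OF assms] Re_greater_minus_1_in_chart[OF assms]
  by (cases "Re (Rep_circle (fst p)) < 1") (blast, fastforce)

lemma closed_submanifold1_zero_circle: "closed_submanifold1 zero_circle"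
  unfolding closed_submanifold1_def
  using compact_zero_circle zero_circle_chart local_param_zero_param
  by (auto simp: zero_circle_def) blast

lemma orientation1_zero_circle: "orientation1 zero_circle zero_orient"
  unfolding orientation1_def using zero_circle_chart pos_param_zero_param by blast

section \<open>Integration of 1-forms over the circle s = 0\<close>

text \<open>The part of an aligned period lying to the left of \<open>c\<close> is shifted by one
  period to its right end.\<close>

lemma integral_periodic:
  fixes g :: "real \<Rightarrow> real"
  assumes g: "continuous_on UNIV g" and P: "P > 0" and per: "\<And>y (n::int). g (y + P * n) = g y"
  shows "integral {c..c + P} g = integral {0..P} g"
proof -
  \<comment> \<open>The largest multiple of the period not exceeding \<open>c\<close>.\<close>
  define m where "m = P * \<lfloor>c / P\<rfloor>"
  have m: "m \<le> c" "c \<le> m + P"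
    using floor_divide_lower[OF P, of c] floor_divide_upper[OF P, of c]
    by (auto simp: m_def algebra_simps)
  have int: "g integrable_on {a..b}" for a b
    using g by (intro integrable_continuous_interval) (rule continuous_on_subset, auto)
  have "integral {m..m + P} g = integral {m..c} g + integral {c..m + P} g"
    using m by (intro Henstock_Kurzweil_Integration.integral_combine[symmetric] int) auto
  moreover have "integral {c..c + P} g = integral {c..m + P} g + integral {m + P..c + P} g"
    using m by (intro Henstock_Kurzweil_Integration.integral_combine[symmetric] int) auto
  moreover have "integral {m + P..c + P} g = integral {m..c} g"
    using integral_shift_Icc_real[of m c g P] per[of _ 1] by (simp add: o_def add.commute)
  moreover have "integral {m..m + P} g = integral {0..P} g"
    using integral_shift_Icc_real[of 0 P g m] per[of _ "\<lfloor>c / P\<rfloor>"] 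
    by (simp add: o_def add.commute m_def)
  ultimately show ?thesis by simp
qed

text \<open>Needed because chart domains are open and the velocity may be unbounded near their ends:
  a compactly supported integrand can be restricted to a closed subinterval, where everything is
  continuous.\<close>

lemma compact_subset_open_interval:
  fixes a b :: real
  assumes "compact K" "K \<subseteq> {a<..<b}" "a < b"
  obtains a' b' where "a < a'" "a' \<le> b'" "b' < b" "K \<subseteq> {a'<..<b'}"
proof (cases "K = {}")
  case True
  then show ?thesis
    using that[of "(a + b) / 2" "(a + b) / 2"] assms by auto
next
  case False
  obtain l h where "l \<in> K" "h \<in> K" "\<And>x. x \<in> K \<Longrightarrow> l \<le> x \<and> x \<le> h"
    using compact_attains_inf[OF assms(1) False] compact_attains_sup[OF assms(1) False] by blast
  moreover then have "a < l" "h < b" "l \<le> h"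
    using assms(2) by auto
  ultimately show ?thesis
    by (intro that[of "(a + l) / 2" "(h + b) / 2"]) force+
qed

text \<open>An arbitrary positive chart has horizontal velocity pointing in direction -1, so it is
  described by a strictly decreasing angle \<open>x\<close>. Injectivity of the chart prevents
  \<open>x\<close> from covering a full period.\<close>

lemma pos_param_zero_circle:
  assumes "pos_param zero_circle zero_orient a b u"
  defines "x \<equiv> \<lambda>t. fst (u t)" and "x' \<equiv> \<lambda>t. fst (vector_derivative u (at t))"
  shows "\<And>t. t \<in> {a<..<b} \<Longrightarrow> Phi (u t) = Phi (x t, 0)"
    and "\<And>t. t \<in> {a<..<b} \<Longrightarrow> vector_derivative u (at t) = (x' t, 0)"
    and "\<And>t. t \<in> {a<..<b} \<Longrightarrow> x' t < 0"
    and "\<And>t. t \<in> {a<..<b} \<Longrightarrow> (x has_real_derivative x' t) (at t)"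
    and "continuous_on {a<..<b} x'"
    and "\<And>s t. a < s \<Longrightarrow> s < t \<Longrightarrow> t < b \<Longrightarrow> x t < x s \<and> x s < x t + 2 * pi"
proof -
  have lp: "local_param zero_circle a b u"
    and vd: "\<And>t. t \<in> {a<..<b} \<Longrightarrow> vector_derivative u (at t)
              = norm (vector_derivative u (at t)) *\<^sub>R (-1, 0)"
    using assms(1) by (auto simp: pos_param_def zero_orient_def)
  have smooth: "smooth_on {a<..<b} u"
    and vd0: "\<And>t. t \<in> {a<..<b} \<Longrightarrow> vector_derivative u (at t) \<noteq> 0"
    using lp by (auto simp: local_param_def)
  have diff: "u differentiable (at t)" if "t \<in> {a<..<b}" for t
    using smooth that by (rule smooth_on_imp_differentiable)
  have "(Phi \<circ> u) ` {a<..<b} \<subseteq> zero_circle"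
    using lp openin_subset by (fastforce simp: local_param_def)
  then show Phi_eq: "Phi (u t) = Phi (x t, 0)" if "t \<in> {a<..<b}" for t
    using that Phi_in_zero_circle_iff[of "u t"] unfolding image_subset_iff x_def by simp
  show "vector_derivative u (at t) = (x' t, 0)" if "t \<in> {a<..<b}" for t
    using vd[OF that] by (simp add: x'_def prod_eq_iff)
  show neg: "x' t < 0" if "t \<in> {a<..<b}" for t
  proof -
    have "x' t = - norm (vector_derivative u (at t))"
      using arg_cong[OF vd[OF that], of fst] by (simp add: x'_def)
    then show ?thesis using vd0[OF that] by simp
  qed
  show deriv: "(x has_real_derivative x' t) (at t)" if "t \<in> {a<..<b}" for t
    using bounded_linear.has_vector_derivative[OF bounded_linear_fst] diff[OF that]
    by (simp add: x_def x'_def vector_derivative_works has_real_derivative_iff_has_vector_derivative)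
  have "continuous_on {a<..<b} (\<lambda>t. fst (frechet_derivative u (at t) 1))"
    by (intro continuous_on_fst smooth_on_imp_continuous_on smooth_on_frechet_derivative smooth)
  then show "continuous_on {a<..<b} x'"
    by (rule continuous_on_eq)
      (simp add: x'_def frechet_derivative_eq_vector_derivative diff)
  fix s t assume st: "a < s" "s < t" "t < b"
  have cont: "continuous_on {s..t} x"
    using st by (intro DERIV_continuous_on[of _ _ x'] DERIV_subset[OF deriv]) auto
  have "x t < x s"
  proof (rule DERIV_neg_imp_decreasing[OF st(2)])
    show "\<exists>y. (x has_real_derivative y) (at r) \<and> y < 0" if "s \<le> r" "r \<le> t" for r
      using deriv[of r] neg[of r] that st by auto
  qed
  \<comment> \<open>Otherwise, by the intermediate value theorem, \<open>x\<close> takes the value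
    \<open>x s - 2 * pi\<close> at some later \<open>r\<close>, and the chart meets the same point
    of the torus twice.\<close>
  moreover have "x s < x t + 2 * pi"
  proof (rule ccontr)
    assume "\<not> x s < x t + 2 * pi"
    then have "\<exists>r\<ge>s. r \<le> t \<and> x r = x s - 2 * pi"
      using st cont by (intro IVT2') auto
    then obtain r where r: "s \<le> r" "r \<le> t" "x r = x s - 2 * pi"
      by blast
    have "Phi (x r, 0) = Phi (x s, 0)"
      unfolding Phi_eq_iff by (auto simp: r intro: exI[of _ "-1"] exI[of _ 0])
    then have "Phi (u r) = Phi (u s)"
      using r st by (simp add: Phi_eq)
    moreover obtain v where "homeomorphism {a<..<b} ((Phi \<circ> u) ` {a<..<b}) (Phi \<circ> u) v"
      using lp by (auto simp: local_param_def)
    then have "inj_on (Phi \<circ> u) {a<..<b}"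
      by (metis homeomorphism_apply1 inj_on_inverseI)
    ultimately have "r = s"
      using r st inj_onD[of "Phi \<circ> u" "{a<..<b}" r s] by auto
    then show False using r by simp
  qed
  ultimately show "x t < x s \<and> x s < x t + 2 * pi" ..
qed

text \<open>Substitute y = x(t). The chart covers only an arc, but the cut-off \<rho> vanishes on
  the rest of the circle, so the arc may be replaced by a full period; the sign appears because
  \<open>x\<close> decreases. The right-hand side no longer mentions the chart.\<close>

lemma chart_integral:
  fixes k :: "torus \<Rightarrow> real"
  assumes pos: "pos_param zero_circle zero_orient a b u"
    and \<rho>: "continuous_on zero_circle \<rho>"
    and supp: "closure {p \<in> zero_circle. \<rho> p \<noteq> 0} \<subseteq> (Phi \<circ> u) ` {a<..<b}"
    and k: "smooth_torus k"
  shows "(LINT t:{a<..<b}|lborel. \<rho> (Phi (u t)) * (k (Phi (u t)) * fst (vector_derivative u (at t))))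
    = - integral {0..2*pi} (\<lambda>y. \<rho> (Phi (y, 0)) * k (Phi (y, 0)))"
proof -
  define x where "x t = fst (u t)" for t
  define x' where "x' t = fst (vector_derivative u (at t))" for t
  note P = pos_param_zero_circle[OF pos, folded x_def x'_def]
  define g where "g = (\<lambda>y. \<rho> (Phi (y, 0)) * k (Phi (y, 0)))"
  have "continuous_on UNIV (\<lambda>y. \<rho> (Phi (y, 0)))"
    by (rule continuous_on_compose2[OF \<rho> continuous_on_Phi_line]) auto
  then have g: "continuous_on UNIV g"
    unfolding g_def by (intro continuous_on_mult continuous_on_smooth_torus[OF k]
        continuous_on_Pair continuous_on_id continuous_on_const)
  then have g': "continuous_on S g" for S
    by (rule continuous_on_subset) auto
  have per: "g (y + 2 * pi * of_int n) = g y" for y and n :: int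
  proof -
    have "Phi (y + 2 * pi * of_int n, 0) = Phi (y, 0)"
      unfolding Phi_eq_iff by (auto intro: exI[of _ 0])
    then show ?thesis by (simp add: g_def)
  qed
  define K where "K = closure {p \<in> zero_circle. \<rho> p \<noteq> 0}"
  obtain v where v: "homeomorphism {a<..<b} ((Phi \<circ> u) ` {a<..<b}) (Phi \<circ> u) v"
    and ab: "a < b"
    using pos by (auto simp: pos_param_def local_param_def)
  have "K \<subseteq> zero_circle"
    unfolding K_def using compact_zero_circle by (intro closure_minimal compact_imp_closed) auto
  then have "zero_circle \<inter> K = K"
    by blast
  moreover have "closed K"
    by (simp add: K_def)
  ultimately have "compact K"
    using compact_Int_closed[OF compact_zero_circle, of K] by argo
  moreover have "continuous_on K v"
    unfolding K_def by (rule continuous_on_subset[OF homeomorphism_cont2[OF v] supp])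
  ultimately have "compact (v ` K)"
    by (intro compact_continuous_image)
  moreover have "v ` K \<subseteq> {a<..<b}"
    using image_mono[OF supp, of v] unfolding K_def homeomorphism_image2[OF v] .
  ultimately obtain a' b' where a'b': "a < a'" "a' \<le> b'" "b' < b" and vK: "v ` K \<subseteq> {a'<..<b'}"
    using ab by (rule compact_subset_open_interval)
  \<comment> \<open>The support of \<rho>, pulled back through the inverse \<open>v\<close> of the
    chart, stays away from both ends of the domain.\<close>
  have K: "t \<in> {a'<..<b'}" if "t \<in> {a<..<b}" "\<rho> (Phi (u t)) \<noteq> 0" for t
  proof -
    have "Phi (u t) \<in> zero_circle"
      using P(1)[OF that(1)] by (simp add: zero_circle_def Phi_def)
    then have "Phi (u t) \<in> K"
      unfolding K_def using that(2) by (intro closure_subset[THEN subsetD] CollectI conjI)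
    moreover have "v (Phi (u t)) = t"
      using homeomorphism_apply1[OF v that(1)] by simp
    ultimately show ?thesis
      using vK imageI[of "Phi (u t)" K v] by (metis subsetD)
  qed
  have x_mono: "x t \<le> x s" "x s \<le> x t + 2 * pi" if "a < s" "s \<le> t" "t < b" for s t
    using P(6)[of s t] that by (cases "s = t", auto)+
  have "(LINT t:{a<..<b}|lborel. \<rho> (Phi (u t)) * (k (Phi (u t)) * x' t))
      = (LINT t:{a<..<b}|lborel. x' t * g (x t))"
    by (rule set_lebesgue_integral_cong) (auto simp: P(1) g_def)
  also have "\<dots> = (LINT t:{a'..b'}|lborel. x' t * g (x t))"
  proof -
    have "indicator {a<..<b} t *\<^sub>R (x' t * g (x t)) = indicator {a'..b'} t *\<^sub>R (x' t * g (x t))" for t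
    proof (cases "t \<in> {a<..<b} \<and> t \<notin> {a'<..<b'}")
      case True
      then have "\<rho> (Phi (x t, 0)) = 0"
        using K[of t] P(1)[of t] by auto
      then show ?thesis by (simp add: g_def)
    qed (use a'b' in \<open>auto simp: indicator_def\<close>)
    then show ?thesis unfolding set_lebesgue_integral_def by (simp only:)
  qed
  also have "\<dots> = integral {a'..b'} (\<lambda>t. x' t * g (x t))"
  proof (rule set_borel_integral_eq_integral(2), rule borel_integrable_atLeastAtMost')
    have "continuous_on {a'..b'} x"
      using a'b' by (intro DERIV_continuous_on[of _ _ x'] DERIV_subset[OF P(4)]) auto
    moreover have "continuous_on {a'..b'} x'"
      using a'b' by (intro continuous_on_subset[OF P(5)]) auto
    ultimately show "continuous_on {a'..b'} (\<lambda>t. x' t * g (x t))"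
      by (intro continuous_intros continuous_on_compose2[OF g]) auto
  qed
  \<comment> \<open>The substitution rule allows either order of the image end points, and an
    integral over a reversed interval is zero. As \<open>x\<close> decreases, only the subtracted
    integral remains.\<close>
  also have "\<dots> = integral {x a'..x b'} g - integral {x b'..x a'} g"
  proof -
    have "((\<lambda>t. x' t *\<^sub>R g (x t)) has_integral integral {x a'..x b'} g - integral {x b'..x a'} g) {a'..b'}"
    proof (rule has_integral_substitution_general[of "{}" a' b' x "x b'" "x a'"])
      show "(x has_real_derivative x' t) (at t within {a'..b'})" if "t \<in> {a'..b'} - {}" for t
        using that a'b' by (intro DERIV_subset[OF P(4)]) auto
      then show "continuous_on {a'..b'} x"
        by (intro DERIV_continuous_on) auto
    qed (use a'b' x_mono g' in auto)
    then show ?thesis by (simp add: integral_unique)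
  qed
  also have "integral {x a'..x b'} g = 0"
    using x_mono(1)[of a' b'] a'b' by (cases "x a' = x b'") auto
  also have "integral {x b'..x a'} g = integral {x b'..x b' + 2 * pi} g"
  proof -
    \<comment> \<open>If \<open>g y\<close> were nonzero, \<open>y\<close> would differ from some
      \<open>x t\<close> with t strictly between a' and b' by \<open>2 * pi * n\<close>. The
      position of \<open>y\<close> puts this difference strictly between 0 and 2 pi, which no
      integer n allows.\<close>
    have "g y = 0" if y: "y \<in> {x a'..x b' + 2 * pi}" for y
    proof (rule ccontr)
      assume "g y \<noteq> 0"
      then have \<rho>y: "\<rho> (Phi (y, 0)) \<noteq> 0" by (simp add: g_def)
      then have "Phi (y, 0) \<in> K"
        unfolding K_def by (intro closure_subset[THEN subsetD]) (simp add: zero_circle_def Phi_def)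
      then obtain t where t: "t \<in> {a<..<b}" "Phi (y, 0) = Phi (u t)"
        using supp by (auto simp: K_def)
      then have "t \<in> {a'<..<b'}"
        using K \<rho>y by simp
      then have lt: "x b' < x t" "x t < x a'"
        using P(6)[of t b'] P(6)[of a' t] a'b' by auto
      obtain n :: int where n: "y = x t + 2 * pi * n"
        using t P(1)[OF t(1)] by (auto simp: Phi_eq_iff)
      have "2 * pi * 0 < 2 * pi * real_of_int n" "2 * pi * real_of_int n < 2 * pi * 1"
        using n y lt unfolding atLeastAtMost_iff by linarith+
      then have "0 < n" "n < 1"
        by (simp_all add: zero_less_mult_iff)
      then show False by simp
    qed
    then have "integral {x a'..x b' + 2 * pi} g = 0"
      using integral_cong[of "{x a'..x b' + 2 * pi}" g "\<lambda>_. 0"] by simp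
    moreover have "integral {x b'..x a'} g + integral {x a'..x b' + 2 * pi} g
        = integral {x b'..x b' + 2 * pi} g"
      using x_mono[of a' b'] a'b' g' by (intro Henstock_Kurzweil_Integration.integral_combine integrable_continuous_interval) auto
    ultimately show ?thesis by simp
  qed
  also have "integral {x b'..x b' + 2 * pi} g = integral {0..2 * pi} g"
    by (rule integral_periodic[OF g _ per]) simp
  finally show ?thesis
    by (simp add: x'_def g_def)
qed

text \<open>Uniqueness of the value: by \<open>chart_integral\<close> each chart contributes an
  integral over the same full period, and there the partition functions add up to 1.\<close>

lemma has_form_integral_zero_circle:
  assumes f: "smooth_torus f" and g: "smooth_torus g"
    and I: "has_form_integral (\<lambda>p v. f p * tderiv g p v) zero_circle zero_orient I"
  shows "I = circle_mean (\<lambda>p. f p * pd1 g p)"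
proof -
  define k where "k = (\<lambda>p. f p * pd1 g p)"
  have k: "smooth_torus k"
    unfolding k_def by (intro smooth_torus_mult smooth_torus_pd1 f g)
  obtain n :: nat and a b u \<rho> where
    c: "\<And>i. i < n \<Longrightarrow> pos_param zero_circle zero_orient (a i) (b i) (u i)"
      "\<And>i. i < n \<Longrightarrow> continuous_on zero_circle (\<rho> i)"
      "\<And>i. i < n \<Longrightarrow> closure {p \<in> zero_circle. \<rho> i p \<noteq> 0} \<subseteq> (Phi \<circ> u i) ` {a i<..<b i}"
    and one: "\<And>p. p \<in> zero_circle \<Longrightarrow> (\<Sum>i<n. \<rho> i p) = 1"
    and I: "I = (\<Sum>i<n. LINT t:{a i<..<b i}|lborel. \<rho> i (Phi (u i t)) *
        (f (Phi (u i t)) * tderiv g (Phi (u i t)) (vector_derivative (u i) (at t))))"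
    using I unfolding has_form_integral_def by blast
  have "(LINT t:{a i<..<b i}|lborel. \<rho> i (Phi (u i t)) *
        (f (Phi (u i t)) * tderiv g (Phi (u i t)) (vector_derivative (u i) (at t))))
      = - integral {0..2*pi} (\<lambda>y. \<rho> i (Phi (y, 0)) * k (Phi (y, 0)))" if i: "i < n" for i
  proof -
    have "f (Phi (u i t)) * tderiv g (Phi (u i t)) (vector_derivative (u i) (at t))
        = k (Phi (u i t)) * fst (vector_derivative (u i) (at t))" if "t \<in> {a i<..<b i}" for t
    proof -
      \<comment> \<open>Only the t-component of dg is seen along the circle.\<close>
      have "snd (vector_derivative (u i) (at t)) = 0"
        using pos_param_zero_circle(2)[OF c(1)[OF i] that] by (metis snd_conv)
      then show ?thesis
        by (simp add: tderiv_eq_pd g k_def)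
    qed
    then have "(LINT t:{a i<..<b i}|lborel. \<rho> i (Phi (u i t)) *
        (f (Phi (u i t)) * tderiv g (Phi (u i t)) (vector_derivative (u i) (at t))))
      = (LINT t:{a i<..<b i}|lborel. \<rho> i (Phi (u i t)) *
        (k (Phi (u i t)) * fst (vector_derivative (u i) (at t))))"
      by (intro set_lebesgue_integral_cong) auto
    also have "\<dots> = - integral {0..2*pi} (\<lambda>y. \<rho> i (Phi (y, 0)) * k (Phi (y, 0)))"
      by (rule chart_integral[OF c(1)[OF i] c(2)[OF i] c(3)[OF i] k])
    finally show ?thesis .
  qed
  then have "I = - (\<Sum>i<n. integral {0..2*pi} (\<lambda>y. \<rho> i (Phi (y, 0)) * k (Phi (y, 0))))"
    by (simp add: I sum_negf)
  also have "(\<Sum>i<n. integral {0..2*pi} (\<lambda>y. \<rho> i (Phi (y, 0)) * k (Phi (y, 0))))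
      = integral {0..2*pi} (\<lambda>y. \<Sum>i<n. \<rho> i (Phi (y, 0)) * k (Phi (y, 0)))"
  proof (rule integral_sum[symmetric])
    fix i assume "i \<in> {..<n}"
    then have "continuous_on {0..2*pi} (\<lambda>y. \<rho> i (Phi (y, 0)))"
      by (intro continuous_on_compose2[OF c(2) continuous_on_Phi_line]) auto
    then show "(\<lambda>y. \<rho> i (Phi (y, 0)) * k (Phi (y, 0))) integrable_on {0..2*pi}"
      by (intro integrable_continuous_interval continuous_on_mult continuous_on_smooth_torus[OF k]
          continuous_on_Pair continuous_on_id continuous_on_const)
  qed auto
  also have "(\<lambda>y. \<Sum>i<n. \<rho> i (Phi (y, 0)) * k (Phi (y, 0))) = (\<lambda>y. k (Phi (y, 0)))"
    by (simp add: one zero_circle_def Phi_def flip: sum_distrib_right)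
  finally show ?thesis
    by (simp add: circle_mean_def k_def)
qed

text \<open>The definite description in \<open>form_integral\<close> also needs one admissible
  choice of data: the two charts covering the circle, with a partition of unity depending only on
  the real part of the first coordinate.\<close>

lemma ex_has_form_integral_zero_circle: "\<exists>I. has_form_integral \<beta> zero_circle zero_orient I"
proof -
  \<comment> \<open>\<open>r\<close> is 1 for real part at most -1/2 and 0 for real part at least
    1/2. Hence the closed supports of \<open>r\<close> and \<open>1 - r\<close> avoid the points 1
    and -1, which their respective charts miss.\<close>
  define r where "r p = max 0 (min 1 (1 / 2 - Re (Rep_circle (fst p))))" for p :: torus
  define a :: "nat \<Rightarrow> real" where "a i = (if i = 0 then 0 else - pi)" for i
  define \<rho> where "\<rho> i = (if i = 0 then r else (\<lambda>p. 1 - r p))" for i :: nat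
  have contR: "continuous_on S (\<lambda>p::torus. Re (Rep_circle (fst p)))" for S
    by (intro continuous_intros continuous_on_compose2[OF continuous_on_Rep_circle]) auto
  have r: "continuous_on S r" for S
    unfolding r_def by (intro continuous_intros contR)
  have "closure {p \<in> zero_circle. r p \<noteq> 0} \<subseteq> {p \<in> zero_circle. Re (Rep_circle (fst p)) \<le> 1 / 2}"
  proof (rule closure_minimal)
    have "closed (zero_circle \<inter> {p. Re (Rep_circle (fst p)) \<le> 1 / 2})"
      by (intro closed_Int closed_Collect_le contR continuous_on_const compact_imp_closed
          compact_zero_circle)
    then show "closed {p \<in> zero_circle. Re (Rep_circle (fst p)) \<le> 1 / 2}"
      by (simp only: Collect_conj_eq Collect_mem_eq)
  qed (auto simp: r_def)
  then have "closure {p \<in> zero_circle. r p \<noteq> 0} \<subseteq> (Phi \<circ> zero_param) ` {0<..<0 + 2 * pi}"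
    by (rule order_trans) (intro subsetI Re_less_1_in_chart, auto)
  moreover have "closure {p \<in> zero_circle. 1 - r p \<noteq> 0}
      \<subseteq> {p \<in> zero_circle. - 1 / 2 \<le> Re (Rep_circle (fst p))}"
  proof (rule closure_minimal)
    have "closed (zero_circle \<inter> {p. - 1 / 2 \<le> Re (Rep_circle (fst p))})"
      by (intro closed_Int closed_Collect_le contR continuous_on_const compact_imp_closed
          compact_zero_circle)
    then show "closed {p \<in> zero_circle. - 1 / 2 \<le> Re (Rep_circle (fst p))}"
      by (simp only: Collect_conj_eq Collect_mem_eq)
  qed (auto simp: r_def)
  then have "closure {p \<in> zero_circle. 1 - r p \<noteq> 0} \<subseteq> (Phi \<circ> zero_param) ` {- pi<..<- pi + 2 * pi}"
    by (rule order_trans) (intro subsetI Re_greater_minus_1_in_chart, auto)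
  ultimately have supp: "closure {p \<in> zero_circle. \<rho> i p \<noteq> 0} \<subseteq> (Phi \<circ> zero_param) ` {a i<..<a i + 2 * pi}" for i
    unfolding \<rho>_def a_def by (cases "i = 0") auto
  have "continuous_on zero_circle (\<rho> i)" "0 \<le> \<rho> i p" for i p
    unfolding \<rho>_def by (auto intro!: r continuous_intros) (auto simp: r_def)
  moreover have "(\<Sum>i<2. \<rho> i p) = 1" for p
    by (simp add: \<rho>_def numeral_2_eq_2)
  ultimately show ?thesis
    unfolding has_form_integral_def
    by (intro exI[of _ "2::nat"] exI exI[of _ a] exI[of _ "\<lambda>i. a i + 2 * pi"]
        exI[of _ "\<lambda>_. zero_param"] exI[of _ \<rho>] conjI refl)
      (use supp pos_param_zero_param in auto)
qed

lemma form_integral_zero_circle: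
  assumes "smooth_torus f" "smooth_torus g"
  shows "form_integral (\<lambda>p v. f p * tderiv g p v) zero_circle zero_orient
    = circle_mean (\<lambda>p. f p * pd1 g p)"
  unfolding form_integral_def
  using ex_has_form_integral_zero_circle has_form_integral_zero_circle[OF assms]
  by (metis (no_types, lifting) the_equality)

theorem proposition3p2:
  fixes \<alpha> :: oneform
  assumes "\<alpha> = (\<lambda>p v. - (1 / (2 * pi)) * theta2 p v)"
  shows "\<exists>N \<tau>. closed_submanifold1 N \<and> orientation1 N \<tau> \<and>
    (\<exists>\<omega>\<alpha>\<in>cocycles 2. \<exists>\<omega>N\<in>cocycles 2.
       (\<forall>f g. smooth_torus f \<and> smooth_torus g \<longrightarrow>
          \<omega>\<alpha> [ham_vf f, ham_vf g] = torus_integral (\<lambda>p. f p * \<alpha> p (ham_vf g p))) \<and>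
       (\<forall>f g. smooth_torus f \<and> smooth_torus g \<longrightarrow>
          \<omega>N [ham_vf f, ham_vf g] = form_integral (\<lambda>p v. f p * tderiv g p v) N \<tau>) \<and>
       (\<lambda>xs. \<omega>\<alpha> xs - \<omega>N xs) \<in> coboundaries 2)"
proof (intro exI conjI, rule closed_submanifold1_zero_circle, rule orientation1_zero_circle,
    rule bexI[of _ "\<lambda>xs. area.omega (xs ! 0) (xs ! 1)"],
    rule bexI[of _ "\<lambda>xs. circle.omega (xs ! 0) (xs ! 1)"], intro conjI allI impI)
  show "(\<lambda>xs. area.omega (xs ! 0) (xs ! 1)) \<in> cocycles 2"
    "(\<lambda>xs. circle.omega (xs ! 0) (xs ! 1)) \<in> cocycles 2"
    by (rule area.omega_cocycle circle.omega_cocycle)+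
  show "(\<lambda>xs. area.omega (xs ! 0) (xs ! 1) - circle.omega (xs ! 0) (xs ! 1)) \<in> coboundaries 2"
    by (rule omega_diff_coboundary)
  fix f g :: "torus \<Rightarrow> real"
  assume *: "smooth_torus f \<and> smooth_torus g"
  then have k: "smooth_torus (\<lambda>p. f p * pd1 g p)"
    by (intro smooth_torus_mult smooth_torus_pd1) auto
  have "torus_integral (\<lambda>p. f p * \<alpha> p (ham_vf g p))
      = torus_integral (\<lambda>p. - (1 / (2 * pi)) * (f p * pd1 g p))"
    by (simp add: assms theta2_def ham_vf_def)
  also have "\<dots> = area_mean (\<lambda>p. f p * pd1 g p)"
    by (subst torus_integral_eq) (simp_all only: smooth_torus_scale k area_mean_def integral_mult_right)
  finally show "area.omega ([ham_vf f, ham_vf g] ! 0) ([ham_vf f, ham_vf g] ! 1)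
      = torus_integral (\<lambda>p. f p * \<alpha> p (ham_vf g p))"
    using * by (simp add: area.omega_ham_vf)
  show "circle.omega ([ham_vf f, ham_vf g] ! 0) ([ham_vf f, ham_vf g] ! 1)
      = form_integral (\<lambda>p v. f p * tderiv g p v) zero_circle zero_orient"
    using * by (simp add: circle.omega_ham_vf form_integral_zero_circle)
qed

end
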